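(* There exist constants $\gamma>0$ and $C>0$, depending only on $d,\lambda,\Lambda,\alpha,\varphi$, such that the following holds. Let $u$ be a bounded continuous function on $\mathbb{R}^d$ satisfying, in the viscosity sense, $$\mathcal{M}^+u\ge -C_0\quad\text{and}\quad \mathcal{M}^-u\le C_0\qquad\text{in }B_1,$$ for some constant $C_0\ge0$. Then $u\in C^\gamma(B_{1/2})$ and $$\|u\|_{C^\gamma(B_{1/2})}\le C\,\bigl(\|u\|_{L^\infty(\mathbb{R}^d)}+C_0\bigr).$$
   Context: Setting. $d\ge1$ is the dimension, $0<\lambda\le\Lambda$ are constants, $\beta\in(0,2)$, $\alpha\in(\beta,2)$. The function $\varphi:(0,\infty)\to(0,\infty)$ is locally bounded and satisfies, for some constant $\kappa_\circ>0$, $\varphi(st)\le\kappa_\circ s^\beta\varphi(t)$ for all $s\ge1$, $t>0$, and $\int_0^1\frac{\varphi(y)}{y}\,dy<\infty$. Dependence of constants on $\varphi$ includes dependence on $\beta,\kappa_\circ$. Operators. $\delta(u,x,y)=u(x+y)+u(x-y)-2u(x)$, with positive and negative parts $\delta^\pm$ ($\delta=\delta^+-\delta^-$), and $$\mathcal{M}^+u(x)=\int_{\mathbb{R}^d}\Bigl[\frac{\Lambda\,\delta^+(u,x,y)}{|y|^d}\Bigl(\frac{2-\alpha}{|y|^\alpha}+\varphi(1/|y|)\Bigr)-\frac{\lambda\,\delta^-(u,x,y)}{|y|^d}\,\frac{2-\alpha}{|y|^\alpha}\Bigr]dy ,$$ $$\mathcal{M}^-u(x)=\int_{\mathbb{R}^d}\Bigl[\frac{\lambda\,\delta^+(u,x,y)}{|y|^d}\,\frac{2-\alpha}{|y|^\alpha}-\frac{\Lambda\,\delta^-(u,x,y)}{|y|^d}\Bigl(\frac{2-\alpha}{|y|^\alpha}+\varphi(1/|y|)\Bigr)\Bigr]dy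 .$$ Viscosity sense. For an open set $\Omega$, a bounded function $u:\mathbb{R}^d\to\mathbb{R}$, upper (lower) semicontinuous in $\overline\Omega$, satisfies $Iu\ge g$ ($Iu\le g$) in $\Omega$ in the viscosity sense if, whenever a $C^2$ function $\psi$ touches $u$ from above (below) at $x\in\Omega$ in a small neighbourhood $N_x\Subset\Omega$ (i.e. $\psi\ge u$, resp. $\psi\le u$, in $N_x$ and $\psi(x)=u(x)$), the function $v$ equal to $\psi$ in $N_x$ and to $u$ elsewhere satisfies $Iv(x)\ge g(x)$ (resp. $Iv(x)\le g(x)$). $B_r$ is the ball of radius $r$ centred at $0$. *)

theory Defs
  imports "HOL-Analysis.Analysis" "HOL-Probability.Essential_Supremum"
begin

definition locally_bounded_on :: "'a::metric_space set \<Rightarrow> ('a \<Rightarrow> real) \<Rightarrow> bool" where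
  "locally_bounded_on S f \<longleftrightarrow> (\<forall>x\<in>S. \<exists>e>0. bounded (f ` (S \<inter> ball x e)))"

definition usc_on :: "'a::topological_space set \<Rightarrow> ('a \<Rightarrow> real) \<Rightarrow> bool" where
  "usc_on S f \<longleftrightarrow> (\<forall>x\<in>S. \<forall>a>f x. eventually (\<lambda>y. f y < a) (at x within S))"

definition lsc_on :: "'a::topological_space set \<Rightarrow> ('a \<Rightarrow> real) \<Rightarrow> bool" where
  "lsc_on S f \<longleftrightarrow> (\<forall>x\<in>S. \<forall>a<f x. eventually (\<lambda>y. a < f y) (at x within S))"

definition C2 :: "('a::real_normed_vector \<Rightarrow> real) \<Rightarrow> bool" where
  "C2 f \<longleftrightarrow>
    (\<exists>(f' :: 'a \<Rightarrow> 'a \<Rightarrow>\<^sub>L real) (f'' :: 'a \<Rightarrow> 'a \<Rightarrow>\<^sub>L 'a \<Rightarrow>\<^sub>L real).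
      (\<forall>x. (f has_derivative blinfun_apply (f' x)) (at x)) \<and>
      (\<forall>x. (f' has_derivative blinfun_apply (f'' x)) (at x)) \<and>
      continuous_on UNIV f'')"

definition second_diff :: "('a::real_normed_vector \<Rightarrow> real) \<Rightarrow> 'a \<Rightarrow> 'a \<Rightarrow> real" where
  "second_diff u x y = u (x + y) + u (x - y) - 2 * u x"

definition second_diff_pos :: "('a::real_normed_vector \<Rightarrow> real) \<Rightarrow> 'a \<Rightarrow> 'a \<Rightarrow> real" where
  "second_diff_pos u x y = max (second_diff u x y) 0"

definition second_diff_neg :: "('a::real_normed_vector \<Rightarrow> real) \<Rightarrow> 'a \<Rightarrow> 'a \<Rightarrow> real" where
  "second_diff_neg u x y = max (- second_diff u x y) 0"

text \<open>
  The parameters are the ellipticity constants \<open>lam \<le> Lam\<close>, the order \<open>\<alpha>\<close> and the function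
  \<open>\<phi>\<close>, of which only the values on \<open>(0,\<infinity>)\<close> matter: at \<open>y = 0\<close> the integrands vanish.
  The integrals are Bochner integrals, equal to \<open>0\<close> by convention for non-integrable
  integrands.  For a bounded measurable \<open>u\<close> that is \<open>C\<^sup>2\<close> near \<open>x\<close>, and \<open>\<phi>\<close> as in the main
  theorem, they converge absolutely; this covers all functions at which the operators are
  evaluated in the viscosity sense below when \<open>u\<close> is continuous and bounded.
\<close>

definition extremal_max ::
    "real \<Rightarrow> real \<Rightarrow> real \<Rightarrow> (real \<Rightarrow> real) \<Rightarrow> ('a::euclidean_space \<Rightarrow> real) \<Rightarrow> 'a \<Rightarrow> real" where
  "extremal_max lam Lam \<alpha> \<phi> u x =
    (LINT y|lebesgue.
       Lam * second_diff_pos u x y / norm y ^ DIM('a) *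
         ((2 - \<alpha>) / norm y powr \<alpha> + \<phi> (1 / norm y))
     - lam * second_diff_neg u x y / norm y ^ DIM('a) * ((2 - \<alpha>) / norm y powr \<alpha>))"

definition extremal_min ::
    "real \<Rightarrow> real \<Rightarrow> real \<Rightarrow> (real \<Rightarrow> real) \<Rightarrow> ('a::euclidean_space \<Rightarrow> real) \<Rightarrow> 'a \<Rightarrow> real" where
  "extremal_min lam Lam \<alpha> \<phi> u x =
    (LINT y|lebesgue.
       lam * second_diff_pos u x y / norm y ^ DIM('a) * ((2 - \<alpha>) / norm y powr \<alpha>)
     - Lam * second_diff_neg u x y / norm y ^ DIM('a) *
         ((2 - \<alpha>) / norm y powr \<alpha> + \<phi> (1 / norm y)))"

text \<open>
  \<open>Iu \<ge> g\<close> and \<open>Iu \<le> g\<close> in \<open>\<Omega>\<close> in the viscosity sense.  Test functions are \<open>C\<^sup>2\<close> on the whole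
  space, and \<open>compact (closure N)\<close> with \<open>closure N \<subseteq> \<Omega>\<close> expresses that \<open>N\<close> is compactly
  contained in \<open>\<Omega>\<close>.
\<close>

definition viscosity_ge ::
    "(('a::euclidean_space \<Rightarrow> real) \<Rightarrow> 'a \<Rightarrow> real) \<Rightarrow> 'a set \<Rightarrow> ('a \<Rightarrow> real) \<Rightarrow> ('a \<Rightarrow> real) \<Rightarrow> bool" where
  "viscosity_ge I \<Omega> u g \<longleftrightarrow>
    open \<Omega> \<and> bounded (range u) \<and> usc_on (closure \<Omega>) u \<and>
    (\<forall>x\<in>\<Omega>. \<forall>N \<psi>.
       open N \<and> x \<in> N \<and> compact (closure N) \<and> closure N \<subseteq> \<Omega> \<and>
       C2 \<psi> \<and> (\<forall>y\<in>N. u y \<le> \<psi> y) \<and> \<psi> x = u x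
       \<longrightarrow> I (\<lambda>y. if y \<in> N then \<psi> y else u y) x \<ge> g x)"

definition viscosity_le ::
    "(('a::euclidean_space \<Rightarrow> real) \<Rightarrow> 'a \<Rightarrow> real) \<Rightarrow> 'a set \<Rightarrow> ('a \<Rightarrow> real) \<Rightarrow> ('a \<Rightarrow> real) \<Rightarrow> bool" where
  "viscosity_le I \<Omega> u g \<longleftrightarrow>
    open \<Omega> \<and> bounded (range u) \<and> lsc_on (closure \<Omega>) u \<and>
    (\<forall>x\<in>\<Omega>. \<forall>N \<psi>.
       open N \<and> x \<in> N \<and> compact (closure N) \<and> closure N \<subseteq> \<Omega> \<and>
       C2 \<psi> \<and> (\<forall>y\<in>N. \<psi> y \<le> u y) \<and> \<psi> x = u x
       \<longrightarrow> I (\<lambda>y. if y \<in> N then \<psi> y else u y) x \<le> g x)"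

definition holder_quotients :: "real \<Rightarrow> 'a::metric_space set \<Rightarrow> ('a \<Rightarrow> real) \<Rightarrow> real set" where
  "holder_quotients \<gamma> S u = {\<bar>u x - u y\<bar> / dist x y powr \<gamma> | x y. x \<in> S \<and> y \<in> S \<and> x \<noteq> y}"

text \<open>
  The space \<open>C\<^sup>\<gamma>(S)\<close> for \<open>0 < \<gamma> < 1\<close>.  Its norm is meaningful when \<open>u\<close> lies in this space and
  \<open>S\<close> has at least two points, since \<open>Sup\<close> on \<open>real\<close> is unspecified for empty or unbounded sets.
\<close>

definition holder_space :: "real \<Rightarrow> 'a::metric_space set \<Rightarrow> ('a \<Rightarrow> real) set" where
  "holder_space \<gamma> S = {u. bounded (u ` S) \<and> bdd_above (holder_quotients \<gamma> S u)}"

definition holder_norm :: "real \<Rightarrow> 'a::metric_space set \<Rightarrow> ('a \<Rightarrow> real) \<Rightarrow> real" where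
  "holder_norm \<gamma> S u = (SUP x\<in>S. \<bar>u x\<bar>) + Sup (holder_quotients \<gamma> S u)"

text \<open>Meaningful for essentially bounded \<open>u\<close>; \<open>real_of_ereal\<close> sends \<open>\<infinity>\<close> to \<open>0\<close>.\<close>

definition Linf_norm :: "('a::euclidean_space \<Rightarrow> real) \<Rightarrow> real" where
  "Linf_norm u = real_of_ereal (esssup lebesgue (\<lambda>x. ereal \<bar>u x\<bar>))"

end

theory Submission
  imports Defs
begin

text \<open>
  Since the constants may depend on \<open>\<alpha>\<close>, Silvestre's measure-theoretic diminish-of-oscillation
  argument applies and no Aleksandrov--Bakelman--Pucci estimate is needed.  If a subsolution is
  below the middle of its range on half of a ball \<open>B\<^sub>r\<close>, but comes close to its maximum on the
  half ball, it is touched from above by a flat paraboloid at a point \<open>x1\<close>.  There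
  the low half contributes at most \<open>- c M r\<^sup>-\<^sup>\<alpha>\<close> to the operator, while the
  paraboloid and the growth outside \<open>B\<^sub>r\<close> contribute a small multiple of \<open>M r\<^sup>-\<^sup>\<alpha>\<close>: for
  \<open>|y| \<le> 1\<close> the kernel \<open>\<phi>(1/|y|)\<close> is dominated by \<open>|y|\<^sup>-\<^sup>\<alpha>\<close> because \<open>\<beta> < \<alpha>\<close>, and for \<open>|y| \<ge> 1\<close> its
  total mass is finite by the Dini condition.  Hence the oscillation decays geometrically on dyadic balls.
\<close>

text \<open>The term with \<phi> destroys scale invariance, so nothing is rescaled to a unit ball:
  each dyadic radius r is treated in place. This works because the positive contribution is still of
  order \<open>M * r powr (- \<alpha>)\<close>, uniformly for r at most 1/2, the order of the gain
  from the low half. It is small against that gain because w(x1) lies within \<epsilon> M / 2 of m +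
  M: the constant part of the growth bound m + M T^\<gamma> cancels in the second difference, and
  only T^\<gamma> - 1 remains, which is at most (2 \<gamma> / \<alpha>) T^(\<alpha>/2). So \<gamma>
  enters as a factor, while the exponent \<alpha>/2 under the integral is fixed, halfway between 0
  and the decay order of the kernel. The constant C of the kernel integral and the gain c are
  therefore known first; then \<epsilon> is chosen, then \<gamma>. The right-hand side C0 is
  absorbed into the initial oscillation bound A: since \<gamma> is below \<alpha>, the quantity
  \<open>M * r powr (- \<alpha>)\<close> does not decrease as the scale shrinks.\<close>

text \<open>
  Radial preimages of null sets are null: apply Fubini to dilations of the space instead of polar
  coordinates.
\<close>

lemma measurable_lebesgue_radial_inverse:
  fixes f :: "real \<Rightarrow> real"
  assumes "f \<in> borel_measurable (lebesgue_on {0<..})"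
  shows "(\<lambda>y::'a::euclidean_space. f (1 / norm y)) \<in> borel_measurable lebesgue"
proof -
  have "(\<lambda>t. if t \<in> {0<..} then f t else 0) \<in> borel_measurable lebesgue"
    using assms by (rule borel_measurable_if_I) simp
  then obtain g where g [measurable]: "g \<in> borel_measurable lborel"
    and ae: "AE t in lborel. (if t \<in> {0<..} then f t else 0) = g t"
    using completion_ex_borel_measurable_real by blast
  from ae obtain Z where Z: "{t. (if t \<in> {0<..} then f t else 0) \<noteq> g t} \<subseteq> Z"
    "emeasure lborel Z = 0" and Zb: "Z \<in> sets lborel"
    by (auto elim!: AE_E)
  have [measurable]: "Z \<in> sets borel" using Zb by simp
  have negZ: "negligible Z"
    using Z(2) Zb by (auto simp: negligible_iff_null_sets intro!: null_sets_completionI)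
  \<comment> \<open>For fixed y the map from t to \<open>t / norm y\<close> is a dilation of the
    line, so Z is hit only for a null set of t. Fubini then exchanges the roles of t and y.\<close>
  have slice: "AE t in lborel. t / norm y \<notin> Z" if "y \<noteq> 0" for y :: 'a
  proof -
    have "negligible ((\<lambda>t. norm y *\<^sub>R t) ` Z)"
      by (rule negligible_differentiable_image_negligible[OF _ negZ]) (auto intro!: derivative_intros)
    moreover have "{t. t / norm y \<in> Z} \<subseteq> (\<lambda>t. norm y *\<^sub>R t) ` Z"
      using that by (auto intro!: image_eqI[where x="_ / norm y"])
    ultimately have "negligible {t. t / norm y \<in> Z}"
      by (rule negligible_subset)
    then have "AE t in lebesgue. t / norm y \<notin> Z"
      by (auto simp: negligible_iff_null_sets AE_iff_null_sets dest: AE_not_in)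
    then show ?thesis
      by (simp add: AE_completion_iff)
  qed
  have "AE y::'a in lborel. AE t in lborel. y \<noteq> 0 \<longrightarrow> t / norm y \<notin> Z"
    using slice by (auto intro!: AE_I2)
  then have "AE t in lborel. AE y::'a in lborel. y \<noteq> 0 \<longrightarrow> t / norm y \<notin> Z"
    by (subst (asm) lborel_pair.AE_commute) measurable
  \<comment> \<open>The full-measure set of good t must contain a positive one, since only then does
    a dilation by 1/t make sense.\<close>
  moreover have "\<not> (AE t::real in lborel. \<not> 0 < t)"
  proof
    assume "AE t::real in lborel. \<not> 0 < t"
    then have "{t::real. 0 < t} \<in> null_sets lborel"
      by (subst AE_iff_null_sets) auto
    then have "emeasure lborel {0<..<1::real} = 0"
      by (metis (no_types, lifting) greaterThanLessThan_iff mem_Collect_eq null_setsD1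
        null_sets_subset sets_lborel borel_open open_greaterThanLessThan subsetI)
    then show False by simp
  qed
  ultimately obtain t where t: "0 < t" "AE y::'a in lborel. y \<noteq> 0 \<longrightarrow> t / norm y \<notin> Z"
    by (metis (mono_tags, lifting) eventually_mono)
  have "negligible {y::'a. y \<noteq> 0 \<and> t / norm y \<in> Z}"
    unfolding negligible_iff_null_sets
    using AE_completion[OF t(2), unfolded completion.AE_iff_null_sets] by simp
  \<comment> \<open>Dilation by 1/t carries the exceptional set for this t to the one for t = 1,
    which is the set in question.\<close>
  then have "negligible ((\<lambda>y. (1 / t) *\<^sub>R y) ` {y::'a. y \<noteq> 0 \<and> t / norm y \<in> Z})"
    by (intro negligible_differentiable_image_negligible) (auto intro!: derivative_intros)
  moreover have "{y::'a. y \<noteq> 0 \<and> 1 / norm y \<in> Z} \<subseteq> (\<lambda>y. (1 / t) *\<^sub>R y) ` {y::'a. y \<noteq> 0 \<and> t / norm y \<in> Z}"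
    using t(1) by (auto intro!: image_eqI[where x="t *\<^sub>R _"])
  ultimately have "negligible (insert 0 {y::'a. y \<noteq> 0 \<and> 1 / norm y \<in> Z})"
    using negligible_subset by (subst negligible_insert) blast
  then have N: "negligible {y::'a. f (1 / norm y) \<noteq> g (1 / norm y)}"
  proof (rule negligible_subset, intro subsetI)
    fix y :: 'a
    assume y: "y \<in> {y. f (1 / norm y) \<noteq> g (1 / norm y)}"
    show "y \<in> insert 0 {y. y \<noteq> 0 \<and> 1 / norm y \<in> Z}"
    proof (cases "y = 0")
      case False
      then have "1 / norm y \<in> {t. (if t \<in> {0<..} then f t else 0) \<noteq> g t}"
        using y by simp
      then show ?thesis using Z(1) False by blast
    qed simp
  qed
  have "(\<lambda>y::'a. g (1 / norm y)) \<in> borel_measurable lebesgue"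
    by (rule measurable_completion) measurable
  moreover have "AE y::'a in lebesgue. g (1 / norm y) = f (1 / norm y)"
    using N unfolding negligible_iff_null_sets by (rule AE_I') (auto simp: eq_commute)
  ultimately show ?thesis by (rule borel_measurable_AE)
qed

section \<open>Integration over dyadic shells\<close>

text \<open>Each shell is enlarged to the ball of radius \<open>2 * s i\<close>, whose volume
  cancels \<open>s i ^ DIM('a)\<close> and leaves \<open>a i\<close> times a dimensional constant.
  Integrals against the kernel thereby reduce to series of dyadic values.\<close>

lemma nn_integral_shells:
  fixes g :: "'a::euclidean_space \<Rightarrow> real" and a s :: "nat \<Rightarrow> real"
  assumes s: "\<And>i. 0 < s i" and a: "\<And>i. 0 \<le> a i" "summable a"
    and cover: "\<And>y. y \<in> S \<Longrightarrow> \<exists>i. s i \<le> norm y \<and> norm y < 2 * s i"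
    and bound: "\<And>i y. y \<in> S \<Longrightarrow> s i \<le> norm y \<Longrightarrow> norm y < 2 * s i \<Longrightarrow> g y \<le> a i / s i ^ DIM('a)"
  shows "(\<integral>\<^sup>+y\<in>S. g y \<partial>lebesgue) \<le> ennreal (unit_ball_vol DIM('a) * 2 ^ DIM('a) * suminf a)"
proof -
  let ?v = "unit_ball_vol DIM('a) * 2 ^ DIM('a)"
  let ?f = "\<lambda>i (y::'a). ennreal (a i / s i ^ DIM('a)) * indicator (ball 0 (2 * s i)) y"
  have "(\<integral>\<^sup>+y\<in>S. g y \<partial>lebesgue) \<le> (\<integral>\<^sup>+y. (\<Sum>i. ?f i y) \<partial>lebesgue)"
  proof (rule nn_integral_mono)
    fix y :: 'a
    show "ennreal (g y) * indicator S y \<le> (\<Sum>i. ?f i y)"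
    proof (cases "y \<in> S")
      case True
      then obtain i where i: "s i \<le> norm y" "norm y < 2 * s i" using cover by blast
      have "ennreal (g y) * indicator S y \<le> ?f i y"
        using bound[OF True i] i True by (simp add: ennreal_leI)
      also have "\<dots> = (\<Sum>j\<in>{i}. ?f j y)" by (subst sum.insert) auto
      also have "\<dots> \<le> (\<Sum>i. ?f i y)" by (rule sum_le_suminf) auto
      finally show ?thesis .
    qed simp
  qed
  also have "\<dots> = (\<Sum>i. \<integral>\<^sup>+y. ?f i y \<partial>lebesgue)"
  proof (rule nn_integral_suminf)
    fix i
    have [measurable]: "ball (0::'a) (2 * s i) \<in> sets lebesgue" by simp
    show "?f i \<in> borel_measurable lebesgue" by measurable
  qed
  also have "\<dots> = (\<Sum>i. ennreal (?v * a i))"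
  proof (rule suminf_cong)
    fix i
    have "(\<integral>\<^sup>+y. ?f i y \<partial>lebesgue) = ennreal (a i / s i ^ DIM('a)) * emeasure lebesgue (ball (0::'a) (2 * s i))"
      by (rule nn_integral_cmult_indicator) auto
    also have "\<dots> = ennreal (a i / s i ^ DIM('a)) * ennreal (unit_ball_vol DIM('a) * (2 * s i) ^ DIM('a))"
      using s[of i] by (simp add: emeasure_ball)
    also have "\<dots> = ennreal (?v * a i)"
      using s[of i] a(1)[of i] by (simp add: ennreal_mult'[symmetric] power_mult_distrib)
    finally show "(\<integral>\<^sup>+y. ?f i y \<partial>lebesgue) = ennreal (?v * a i)" .
  qed
  also have "\<dots> = ennreal (\<Sum>i. ?v * a i)"
    using a by (intro suminf_ennreal2 summable_mult) auto
  also have "\<dots> = ennreal (?v * suminf a)"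
    using a by (simp add: suminf_mult)
  finally show ?thesis .
qed


lemma dyadic_down:
  fixes t :: real
  assumes "0 < t" "t < 1"
  shows "\<exists>i::nat. (1/2) ^ Suc i \<le> t \<and> t < (1/2) ^ i"
proof -
  have ex: "\<exists>n. (1/2) ^ n \<le> t"
    using real_arch_pow_inv[OF assms(1), of "1/2"] by (auto intro: less_imp_le)
  define n where "n = (LEAST n. (1/2) ^ n \<le> t)"
  have n: "(1/2) ^ n \<le> t" unfolding n_def by (rule LeastI_ex[OF ex])
  have "n \<noteq> 0" using n assms by (intro notI) auto
  then obtain i where i: "n = Suc i" by (cases n) auto
  then have "\<not> (1/2) ^ i \<le> t" unfolding n_def by (intro not_less_Least) simp
  with n i show ?thesis by (intro exI[of _ i]) auto
qed

lemma dyadic_up: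
  fixes t :: real
  assumes "1 \<le> t"
  shows "\<exists>i::nat. 2 ^ i \<le> t \<and> t < 2 * 2 ^ i"
proof -
  have ex: "\<exists>n. t < 2 ^ n"
    using real_arch_pow[of 2 t] by auto
  define n where "n = (LEAST n. t < 2 ^ n)"
  have n: "t < 2 ^ n" unfolding n_def by (rule LeastI_ex[OF ex])
  have "n \<noteq> 0" using n assms by (intro notI) auto
  then obtain i where i: "n = Suc i" by (cases n) auto
  then have "\<not> t < 2 ^ i" unfolding n_def by (intro not_less_Least) simp
  with n i show ?thesis by (intro exI[of _ i]) auto
qed

section \<open>The kernel and its weighted integral\<close>

locale extremal_kernel =
  fixes lam Lam \<alpha> \<beta> \<kappa> :: real and \<phi> :: "real \<Rightarrow> real"
  assumes lam_pos: "0 < lam" and lam_le: "lam \<le> Lam"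
    and beta_pos: "0 < \<beta>" and beta_less: "\<beta> < \<alpha>" and alpha_less: "\<alpha> < 2"
    and phi_pos: "\<And>t. 0 < t \<Longrightarrow> 0 < \<phi> t"
    and phi_measurable: "\<phi> \<in> borel_measurable (lebesgue_on {0<..})"
    and kappa_pos: "0 < \<kappa>"
    and phi_scaling: "\<And>s t. 1 \<le> s \<Longrightarrow> 0 < t \<Longrightarrow> \<phi> (s * t) \<le> \<kappa> * s powr \<beta> * \<phi> t"
    and phi_Dini: "set_integrable lebesgue {0<..<1} (\<lambda>y. \<phi> y / y)"
begin

lemma Lam_pos: "0 < Lam" and alpha_pos: "0 < \<alpha>"
  using lam_pos lam_le beta_pos beta_less by auto

text \<open>The Dini integral in dyadic form. The scaling hypothesis bounds \<phi> at a larger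
  argument by \<phi> at a smaller one, so on each dyadic interval the value at the right end is
  controlled by every value inside, at the cost of \<kappa> 2^\<beta>.\<close>

lemma summable_phi_dyadic: "summable (\<lambda>i. \<phi> ((1/2) ^ Suc i))"
proof -
  define I where "I i = {(1/2) ^ Suc (Suc i)..<(1/2) ^ Suc i :: real}" for i :: nat
  \<comment> \<open>A lower bound for \<open>\<phi> t / t\<close> on \<open>I i\<close>: the first
    factor comes from scaling by a ratio of at most 2, the factor \<open>2 ^ Suc i\<close> from
    \<open>t < (1/2) ^ Suc i\<close>.\<close>
  define b where "b i = \<phi> ((1/2) ^ Suc i) * 2 ^ Suc i / (\<kappa> * 2 powr \<beta>)" for i :: nat
  have b_pos: "0 \<le> b i" for i
    unfolding b_def using phi_pos[of "(1/2) ^ Suc i"] kappa_pos by simp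
  have disj: "disjoint_family I"
    unfolding disjoint_family_on_def
  proof (intro ballI impI)
    have *: "I i \<inter> I j = {}" if "i < j" for i j
    proof -
      have "(1/2::real) ^ Suc j \<le> (1/2) ^ Suc (Suc i)"
        using that by (intro power_decreasing) auto
      then show ?thesis unfolding I_def by (force simp del: power_Suc)
    qed
    show "I i \<inter> I j = {}" if "i \<noteq> j" for i j
      using *[of i j] *[of j i] that by (cases i j rule: linorder_cases) auto
  qed
  have le: "b i \<le> \<phi> t / t" if "t \<in> I i" for i t
  proof -
    have t: "0 < t" "(1/2) ^ Suc (Suc i) \<le> t" "t < (1/2) ^ Suc i"
      using that unfolding I_def by (auto intro: less_le_trans[OF zero_less_power[of "1/2"]] simp del: power_Suc)
    define q where "q = (1/2) ^ Suc i / t"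
    have q: "1 \<le> q" "q \<le> 2" using t by (simp_all add: q_def field_simps)
    have "\<phi> ((1/2) ^ Suc i) = \<phi> (q * t)" using t by (simp add: q_def)
    also have "\<dots> \<le> \<kappa> * q powr \<beta> * \<phi> t" using q t by (intro phi_scaling) auto
    also have "\<dots> \<le> \<kappa> * 2 powr \<beta> * \<phi> t"
      using q kappa_pos beta_pos phi_pos[OF t(1)]
      by (intro mult_right_mono mult_left_mono powr_mono2) auto
    finally have "\<phi> ((1/2) ^ Suc i) / (\<kappa> * 2 powr \<beta>) \<le> \<phi> t"
      using kappa_pos by (simp add: field_simps)
    moreover have "2 ^ Suc i \<le> 1 / t"
      using t by (simp add: field_simps power_one_over)
    ultimately have "\<phi> ((1/2) ^ Suc i) / (\<kappa> * 2 powr \<beta>) * 2 ^ Suc i \<le> \<phi> t * (1 / t)"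
      using phi_pos[OF t(1)] by (intro mult_mono) auto
    then show ?thesis by (simp add: b_def)
  qed
  let ?F = "\<lambda>t. indicat_real {0<..<1} t *\<^sub>R (\<phi> t / t)"
  have "(\<Sum>i. ennreal (b i * (1/2) ^ Suc (Suc i))) = (\<Sum>i. \<integral>\<^sup>+t. ennreal (b i) * indicator (I i) t \<partial>lebesgue)"
  proof (rule suminf_cong)
    fix i
    have "(\<integral>\<^sup>+t. ennreal (b i) * indicator (I i) t \<partial>lebesgue) = ennreal (b i) * emeasure lebesgue (I i)"
      by (rule nn_integral_cmult_indicator) (simp add: I_def)
    also have "emeasure lebesgue (I i) = ennreal ((1/2) ^ Suc i - (1/2) ^ Suc (Suc i))"
      unfolding I_def by (simp add: emeasure_lborel_Ico)
    also have "(1/2) ^ Suc i - (1/2) ^ Suc (Suc i) = ((1/2) ^ Suc (Suc i) :: real)" by simp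
    finally show "ennreal (b i * (1/2) ^ Suc (Suc i)) = (\<integral>\<^sup>+t. ennreal (b i) * indicator (I i) t \<partial>lebesgue)"
      using b_pos[of i] by (simp add: ennreal_mult'[symmetric])
  qed
  also have "\<dots> = (\<integral>\<^sup>+t. (\<Sum>i. ennreal (b i) * indicator (I i) t) \<partial>lebesgue)"
  proof (rule nn_integral_suminf[symmetric])
    fix i
    have [measurable]: "I i \<in> sets lebesgue" by (simp add: I_def)
    show "(\<lambda>t. ennreal (b i) * indicator (I i) t) \<in> borel_measurable lebesgue" by measurable
  qed
  also have "\<dots> \<le> (\<integral>\<^sup>+t. ennreal (norm (?F t)) \<partial>lebesgue)"
  proof (rule nn_integral_mono)
    fix t :: real
    show "(\<Sum>i. ennreal (b i) * indicator (I i) t) \<le> ennreal (norm (?F t))"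
    proof (cases "\<exists>i. t \<in> I i")
      case True
      then obtain i where i: "t \<in> I i" by blast
      then have t: "0 < t" "t < 1"
        unfolding I_def atLeastLessThan_iff
        using power_le_one[of "1/2::real" "Suc i"] zero_less_power[of "1/2::real" "Suc (Suc i)"] by linarith+
      have "(\<Sum>i. ennreal (b i) * indicator (I i) t) = ennreal (b i)"
        by (rule suminf_cmult_indicator[OF disj i])
      also have "\<dots> \<le> ennreal (norm (?F t))"
        using le[OF i] t phi_pos[OF t(1)] by (intro ennreal_leI) simp
      finally show ?thesis .
    next
      case False
      then have "(\<lambda>i. ennreal (b i) * indicator (I i) t) = (\<lambda>_. 0)" by auto
      then show ?thesis by simp
    qed
  qed
  also have "\<dots> < \<infinity>"
    using phi_Dini unfolding set_integrable_def integrable_iff_bounded by blast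
  finally have "summable (\<lambda>i. b i * (1/2) ^ Suc (Suc i))"
    using b_pos by (intro summable_suminf_not_top) (simp_all add: less_top)
  then have "summable (\<lambda>i. (2 * (\<kappa> * 2 powr \<beta>)) * (b i * (1/2) ^ Suc (Suc i)))"
    by (rule summable_mult)
  also have "(\<lambda>i. (2 * (\<kappa> * 2 powr \<beta>)) * (b i * (1/2) ^ Suc (Suc i))) = (\<lambda>i. \<phi> ((1/2) ^ Suc i))"
    using kappa_pos by (auto simp: b_def power_one_over field_simps)
  finally show ?thesis .
qed

definition upper_kernel :: "'a::euclidean_space \<Rightarrow> real" where
  "upper_kernel y = Lam / norm y ^ DIM('a) * ((2 - \<alpha>) / norm y powr \<alpha> + \<phi> (1 / norm y))"

text \<open>
  Controls the positive part of the second difference of the function in the oscillation step at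
  scale \<open>r\<close>: \<open>|y|\<^sup>2 / r\<^sup>2\<close> comes from the touching paraboloid, the second branch from the admissible
  growth of the solution, which is capped at unit distance because the tail of the kernel has only
  the Dini integrability of \<open>\<phi>\<close>.
\<close>

definition weight :: "real \<Rightarrow> 'a::euclidean_space \<Rightarrow> real" where
  "weight r y = (if norm y < r / 4 then (norm y / r)\<^sup>2 else (min (8 * norm y) 1 / r) powr (\<alpha> / 2))"

lemma upper_kernel_nonneg: "0 \<le> upper_kernel (y::'a::euclidean_space)"
proof (cases "y = 0")
  case False
  then show ?thesis using phi_pos[of "1 / norm y"] Lam_pos alpha_less by (simp add: upper_kernel_def)
qed (simp add: upper_kernel_def zero_power)

lemma weight_nonneg: "0 \<le> weight r y"
  by (simp add: weight_def)

lemma measurable_phi_radial [measurable]: "(\<lambda>y::'a::euclidean_space. \<phi> (1 / norm y)) \<in> borel_measurable lebesgue"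
  by (rule measurable_lebesgue_radial_inverse[OF phi_measurable])

lemma borel_imp_lebesgue: "f \<in> borel_measurable borel \<Longrightarrow> f \<in> borel_measurable lebesgue"
  by (rule measurable_completion) simp

lemma measurable_norm_lebesgue [measurable]: "(norm :: 'a::euclidean_space \<Rightarrow> real) \<in> borel_measurable lebesgue"
  by (rule borel_imp_lebesgue) measurable

lemma measurable_upper_kernel [measurable]: "(upper_kernel :: 'a::euclidean_space \<Rightarrow> real) \<in> borel_measurable lebesgue"
  unfolding upper_kernel_def[abs_def] by measurable

lemma measurable_weight [measurable]: "(weight r :: 'a::euclidean_space \<Rightarrow> real) \<in> borel_measurable lebesgue"
  unfolding weight_def[abs_def] by measurable

lemma upper_kernel_le:
  fixes y :: "'a::euclidean_space"
  assumes "y \<noteq> 0" "norm y \<le> 1"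
  shows "upper_kernel y \<le> Lam * (2 - \<alpha> + \<kappa> * \<phi> 1) * norm y powr (- \<alpha>) / norm y ^ DIM('a)"
proof -
  have y: "0 < norm y" using assms by simp
  have "\<phi> (1 / norm y * 1) \<le> \<kappa> * (1 / norm y) powr \<beta> * \<phi> 1"
    using y assms by (intro phi_scaling) auto
  also have "\<dots> \<le> \<kappa> * (1 / norm y) powr \<alpha> * \<phi> 1"
    using y assms beta_less kappa_pos phi_pos[of 1] by (intro mult_right_mono mult_left_mono powr_mono) auto
  also have "(1 / norm y) powr \<alpha> = norm y powr (- \<alpha>)"
    using y by (simp add: powr_minus powr_divide divide_simps)
  finally have "(2 - \<alpha>) / norm y powr \<alpha> + \<phi> (1 / norm y) \<le> (2 - \<alpha> + \<kappa> * \<phi> 1) * norm y powr (- \<alpha>)"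
    using y by (simp add: powr_minus field_simps)
  then have "Lam / norm y ^ DIM('a) * ((2 - \<alpha>) / norm y powr \<alpha> + \<phi> (1 / norm y))
    \<le> Lam / norm y ^ DIM('a) * ((2 - \<alpha> + \<kappa> * \<phi> 1) * norm y powr (- \<alpha>))"
    using Lam_pos by (intro mult_left_mono) auto
  then show ?thesis by (simp add: upper_kernel_def field_simps)
qed

text \<open>Three regions give three convergent series. Below r/4 the terms decay with ratio
  2^(\<alpha>-2), because the quadratic weight beats the singularity. From r/4 to 1 the ratio is
  2^(-\<alpha>/2), because the weight grows with only half the order of the kernel. Beyond 1 the
  weight is constant and \<open>summable_phi_dyadic\<close> takes over. The first two series scale
  exactly like \<open>r powr (- \<alpha>)\<close>; the third is smaller in r and is bounded by
  it.\<close>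

lemma nn_integral_kernel_weight:
  obtains C where "0 < C"
    "\<And>r. 0 < r \<Longrightarrow> r \<le> 1/2 \<Longrightarrow>
      (\<integral>\<^sup>+y. upper_kernel y * weight r y \<partial>(lebesgue :: 'a::euclidean_space measure)) \<le> ennreal (C * r powr (- \<alpha>))"
proof -
  define d where "d = DIM('a)"
  define V where "V = unit_ball_vol d * 2 ^ d"
  define C1 where "C1 = Lam * (2 - \<alpha> + \<kappa> * \<phi> 1)"
  define q where "q = (1/2) powr (2 - \<alpha>)"
  define p where "p = (1/2) powr (\<alpha> / 2)"
  define a3 where "a3 i = Lam * ((2 - \<alpha>) * ((1/2) powr \<alpha>) ^ i + \<kappa> * 2 powr \<beta> * \<phi> ((1/2) ^ Suc i))" for i :: nat
  have C1: "0 < C1"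
    unfolding C1_def using Lam_pos alpha_less kappa_pos phi_pos[of 1] by (intro mult_pos_pos add_pos_pos) auto
  have half_powr: "0 < (1/2::real) powr x \<and> (1/2::real) powr x < 1" if "0 < x" for x
    using that powr_less_mono2[of x "1/2" 1] by auto
  have half_pow: "((1/2::real) ^ i) powr x = ((1/2) powr x) ^ i" for x and i :: nat
    by (simp add: powr_power powr_realpow[symmetric] powr_powr mult.commute)
  have q: "0 < q" "q < 1" and p: "0 < p" "p < 1"
    using half_powr[of "2 - \<alpha>"] half_powr[of "\<alpha> / 2"] alpha_pos alpha_less by (auto simp: q_def p_def)
  have sum3: "summable a3"
    unfolding a3_def using half_powr[OF alpha_pos] summable_phi_dyadic
    by (intro summable_mult summable_add summable_geometric) auto
  have a3: "0 \<le> a3 i" for i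
    unfolding a3_def using Lam_pos alpha_less kappa_pos phi_pos[of "(1/2) ^ Suc i"]
    by (intro mult_nonneg_nonneg add_nonneg_nonneg) auto
  define C where "C = V * (C1 / (1 - q)) + V * (32 * C1 / (1 - p)) + V * suminf a3"
  have V: "0 < V" by (simp add: V_def)
  have "0 < C"
    unfolding C_def using V C1 p q suminf_nonneg[OF sum3 a3]
    by (intro add_pos_nonneg add_pos_pos mult_pos_pos divide_pos_pos mult_nonneg_nonneg) auto
  moreover have "(\<integral>\<^sup>+y. upper_kernel y * weight r y \<partial>(lebesgue :: 'a measure)) \<le> ennreal (C * r powr (- \<alpha>))"
    if r: "0 < r" "r \<le> 1/2" for r
  proof -
    define R where "R = r powr (- \<alpha>)"
    have R: "0 < R" using r by (simp add: R_def)
    let ?g = "\<lambda>y::'a. upper_kernel y * weight r y"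
    let ?S1 = "{y::'a. y \<noteq> 0 \<and> norm y < r / 4}"
    let ?S2 = "{y::'a. r / 4 \<le> norm y \<and> norm y \<le> 1}"
    let ?S3 = "{y::'a. 1 < norm y}"
    have near: "(\<integral>\<^sup>+y\<in>?S1. ?g y \<partial>lebesgue) \<le> ennreal (V * (\<Sum>i. C1 * R * q ^ i))"
      unfolding V_def d_def
    proof (rule nn_integral_shells[where s="\<lambda>i. r / 4 * (1/2) ^ Suc i"])
      fix y :: 'a assume "y \<in> ?S1"
      then have "0 < norm y / (r / 4)" "norm y / (r / 4) < 1" using r by auto
      from dyadic_down[OF this] obtain i where "(1/2) ^ Suc i \<le> norm y / (r / 4)" "norm y / (r / 4) < (1/2) ^ i"
        by blast
      then show "\<exists>i. r / 4 * (1/2) ^ Suc i \<le> norm y \<and> norm y < 2 * (r / 4 * (1/2) ^ Suc i)"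
        using r by (intro exI[of _ i]) (simp add: field_simps)
    next
      fix i and y :: 'a
      let ?s = "r / 4 * (1/2) ^ Suc i"
      assume y: "y \<in> ?S1" "?s \<le> norm y" "norm y < 2 * ?s"
      have n: "0 < norm y" using y by simp
      have s: "0 < ?s" using r by simp
      \<comment> \<open>The factor 1/4 in the shell radius is given away; only the ratio of the
        geometric series matters.\<close>
      have "norm y powr (2 - \<alpha>) \<le> (r * (1/2) ^ i) powr (2 - \<alpha>)"
        using y r alpha_less by (intro powr_mono2) (auto intro: order_trans[OF less_imp_le])
      also have "\<dots> = r powr (2 - \<alpha>) * q ^ i"
        using r by (simp only: powr_mult half_pow q_def)
      also have "r powr (2 - \<alpha>) = r\<^sup>2 * R"
        using r by (simp add: R_def powr_diff powr_minus divide_simps)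
      finally have le: "norm y powr (2 - \<alpha>) / r\<^sup>2 \<le> R * q ^ i" using r by (simp add: field_simps)
      have "?g y \<le> C1 * norm y powr (- \<alpha>) / norm y ^ DIM('a) * (norm y / r)\<^sup>2"
        using mult_right_mono[OF upper_kernel_le[of y], of "(norm y / r)\<^sup>2"] y r by (simp add: weight_def C1_def)
      also have "\<dots> = C1 * (norm y powr (2 - \<alpha>) / r\<^sup>2) / norm y ^ DIM('a)"
        using n by (simp add: powr_diff powr_minus field_simps)
      also have "\<dots> \<le> C1 * (R * q ^ i) / ?s ^ DIM('a)"
        using le C1 s y(2) r R q by (intro frac_le mult_left_mono power_mono mult_nonneg_nonneg) auto
      finally show "?g y \<le> C1 * R * q ^ i / ?s ^ DIM('a)" by (simp add: mult.assoc)
    qed (use r C1 R q in \<open>auto intro!: summable_mult summable_geometric\<close>)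
    have mid: "(\<integral>\<^sup>+y\<in>?S2. ?g y \<partial>lebesgue) \<le> ennreal (V * (\<Sum>i. 32 * C1 * R * p ^ i))"
      unfolding V_def d_def
    proof (rule nn_integral_shells[where s="\<lambda>i. r / 4 * 2 ^ i"])
      fix y :: 'a assume "y \<in> ?S2"
      then have "1 \<le> norm y / (r / 4)" using r by (auto simp: field_simps)
      from dyadic_up[OF this] show "\<exists>i. r / 4 * 2 ^ i \<le> norm y \<and> norm y < 2 * (r / 4 * 2 ^ i)"
        using r by (auto simp: field_simps)
    next
      fix i and y :: 'a
      let ?s = "r / 4 * 2 ^ i"
      assume y: "y \<in> ?S2" "?s \<le> norm y" "norm y < 2 * ?s"
      have n: "0 < norm y" using y r by auto
      have s: "0 < ?s" using r by simp
      have "(8 * norm y / r) powr (\<alpha> / 2) * norm y powr (- \<alpha>) = (8 / (r * norm y)) powr (\<alpha> / 2)"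
      proof -
        have "norm y powr (- \<alpha>) = (1 / (norm y * norm y)) powr (\<alpha> / 2)"
          using n by (simp add: powr_divide powr_mult powr_minus powr_add[symmetric] divide_simps)
        then show ?thesis using n r by (simp add: powr_mult[symmetric])
      qed
      also have "\<dots> \<le> (8 / (r * ?s)) powr (\<alpha> / 2)"
        using y s n r alpha_pos by (intro powr_mono2 divide_left_mono mult_left_mono mult_pos_pos) auto
      \<comment> \<open>The 32 is 8 from the weight times 4 from the innermost radius r/4; since
        \<alpha>/2 is below 1, its power is again bounded by 32.\<close>
      also have "8 / (r * ?s) = 32 * ((1 / (r * r)) * (1/2) ^ i)"
        using r by (simp add: field_simps power_one_over)
      also have "\<dots> powr (\<alpha> / 2) = 32 powr (\<alpha> / 2) * ((1 / (r * r)) powr (\<alpha> / 2) * p ^ i)"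
        using r by (simp only: powr_mult half_pow p_def)
      also have "(1 / (r * r)) powr (\<alpha> / 2) = R"
        using r by (simp add: R_def powr_divide powr_mult powr_minus powr_add[symmetric] divide_simps)
      also have "32 powr (\<alpha> / 2) * (R * p ^ i) \<le> 32 * (R * p ^ i)"
        using powr_mono[of "\<alpha> / 2" 1 "32::real"] alpha_less R p by (intro mult_right_mono) auto
      finally have le: "(8 * norm y / r) powr (\<alpha> / 2) * norm y powr (- \<alpha>) \<le> 32 * (R * p ^ i)" .
      have "weight r y \<le> (8 * norm y / r) powr (\<alpha> / 2)"
        using y r alpha_pos by (auto simp: weight_def intro!: powr_mono2 divide_right_mono)
      then have "?g y \<le> (C1 * norm y powr (- \<alpha>) / norm y ^ DIM('a)) * (8 * norm y / r) powr (\<alpha> / 2)"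
        using upper_kernel_le[of y] y n C1 weight_nonneg[of r y] by (intro mult_mono) (auto simp: C1_def)
      also have "\<dots> = C1 * ((8 * norm y / r) powr (\<alpha> / 2) * norm y powr (- \<alpha>)) / norm y ^ DIM('a)"
        by (simp add: field_simps)
      also have "\<dots> \<le> C1 * (32 * (R * p ^ i)) / ?s ^ DIM('a)"
        using le C1 s y(2) r R p by (intro frac_le mult_left_mono power_mono mult_nonneg_nonneg) auto
      finally show "?g y \<le> 32 * C1 * R * p ^ i / ?s ^ DIM('a)" by (simp add: mult_ac)
    qed (use r C1 R p in \<open>auto intro!: summable_mult summable_geometric\<close>)
    have far: "(\<integral>\<^sup>+y\<in>?S3. ?g y \<partial>lebesgue) \<le> ennreal (V * (\<Sum>i. R * a3 i))"
      unfolding V_def d_def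
    proof (rule nn_integral_shells[where s="\<lambda>i. 2 ^ i"])
      fix y :: 'a assume "y \<in> ?S3"
      then have "1 \<le> norm y" by auto
      from dyadic_up[OF this] show "\<exists>i. 2 ^ i \<le> norm y \<and> norm y < 2 * 2 ^ i" .
    next
      fix i and y :: 'a
      assume y: "y \<in> ?S3" "2 ^ i \<le> norm y" "norm y < 2 * 2 ^ i"
      have n: "0 < norm y" using y by auto
      define s where "s = 2 ^ Suc i / norm y"
      \<comment> \<open>\<open>1 / norm y\<close> is compared with the left end of its dyadic
        interval, the only direction that the scaling hypothesis permits.\<close>
      have s: "1 \<le> s" "s \<le> 2" using y n by (simp_all add: s_def field_simps)
      have "\<phi> (1 / norm y) = \<phi> (s * (1/2) ^ Suc i)"
        by (simp add: s_def power_one_over)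
      also have "\<dots> \<le> \<kappa> * s powr \<beta> * \<phi> ((1/2) ^ Suc i)"
        using s by (intro phi_scaling) auto
      also have "\<dots> \<le> \<kappa> * 2 powr \<beta> * \<phi> ((1/2) ^ Suc i)"
        using s kappa_pos beta_pos phi_pos[of "(1/2) ^ Suc i"]
        by (intro mult_right_mono mult_left_mono powr_mono2) auto
      finally have phi: "\<phi> (1 / norm y) \<le> \<kappa> * 2 powr \<beta> * \<phi> ((1/2) ^ Suc i)" .
      have "1 / norm y powr \<alpha> = (1 / norm y) powr \<alpha>" using n by (simp add: powr_divide)
      also have "\<dots> \<le> ((1/2) ^ i) powr \<alpha>"
        using y n alpha_pos by (intro powr_mono2) (auto simp: power_one_over field_simps)
      also have "\<dots> = ((1/2) powr \<alpha>) ^ i" by (rule half_pow)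
      finally have "(2 - \<alpha>) * (1 / norm y powr \<alpha>) \<le> (2 - \<alpha>) * ((1/2) powr \<alpha>) ^ i"
        using alpha_less by (intro mult_left_mono) auto
      with phi have "Lam * ((2 - \<alpha>) / norm y powr \<alpha> + \<phi> (1 / norm y)) \<le> a3 i"
        unfolding a3_def using Lam_pos by (intro mult_left_mono) auto
      moreover have "weight r y \<le> R"
      proof -
        have "weight r y = (1 / r) powr (\<alpha> / 2)" using y r by (auto simp: weight_def)
        also have "\<dots> \<le> (1 / r) powr \<alpha>" using r alpha_pos by (intro powr_mono) auto
        finally show ?thesis using r by (simp add: R_def powr_divide powr_minus divide_simps)
      qed
      ultimately have "Lam * ((2 - \<alpha>) / norm y powr \<alpha> + \<phi> (1 / norm y)) * weight r y \<le> a3 i * R"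
        using a3[of i] weight_nonneg[of r y] by (intro mult_mono) auto
      then have "Lam * ((2 - \<alpha>) / norm y powr \<alpha> + \<phi> (1 / norm y)) * weight r y / norm y ^ DIM('a)
          \<le> a3 i * R / (2 ^ i) ^ DIM('a)"
        using a3[of i] R y by (intro frac_le power_mono mult_nonneg_nonneg) auto
      then show "?g y \<le> R * a3 i / (2 ^ i) ^ DIM('a)"
        by (simp add: upper_kernel_def mult_ac)
    qed (use a3 sum3 R in \<open>auto intro!: summable_mult\<close>)
    have "?S1 \<in> sets borel" "?S2 \<in> sets borel" "?S3 \<in> sets borel"
      by measurable
    then have [measurable]: "?S1 \<in> sets lebesgue" "?S2 \<in> sets lebesgue" "?S3 \<in> sets lebesgue"
      by (auto intro: sets_completionI_sets)
    have "(\<integral>\<^sup>+y. ?g y \<partial>lebesgue)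
      \<le> (\<integral>\<^sup>+y. ennreal (?g y) * indicator ?S1 y + (ennreal (?g y) * indicator ?S2 y + ennreal (?g y) * indicator ?S3 y) \<partial>lebesgue)"
    proof (rule nn_integral_mono)
      fix y :: 'a
      \<comment> \<open>The origin lies in none of the three regions, but the weight vanishes
        there.\<close>
      show "ennreal (?g y) \<le> ennreal (?g y) * indicator ?S1 y + (ennreal (?g y) * indicator ?S2 y + ennreal (?g y) * indicator ?S3 y)"
        using r by (cases "y = 0") (auto simp: indicator_def upper_kernel_def weight_def)
    qed
    also have "\<dots> = (\<integral>\<^sup>+y\<in>?S1. ?g y \<partial>lebesgue) + ((\<integral>\<^sup>+y\<in>?S2. ?g y \<partial>lebesgue) + (\<integral>\<^sup>+y\<in>?S3. ?g y \<partial>lebesgue))"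
    proof -
      have "(\<lambda>y. ennreal (?g y) * indicator S y) \<in> borel_measurable lebesgue"
        if [measurable]: "S \<in> sets lebesgue" for S
        by measurable
      note meas = this[OF \<open>?S1 \<in> sets lebesgue\<close>] this[OF \<open>?S2 \<in> sets lebesgue\<close>]
        this[OF \<open>?S3 \<in> sets lebesgue\<close>]
      show ?thesis by (simp only: nn_integral_add borel_measurable_add meas)
    qed
    also have "\<dots> \<le> ennreal (V * (\<Sum>i. C1 * R * q ^ i)) + (ennreal (V * (\<Sum>i. 32 * C1 * R * p ^ i)) + ennreal (V * (\<Sum>i. R * a3 i)))"
      by (intro add_mono near mid far)
    also have "(\<Sum>i. C1 * R * q ^ i) = C1 / (1 - q) * R"
      using q by (simp add: suminf_mult suminf_geometric summable_geometric)
    also have "(\<Sum>i. 32 * C1 * R * p ^ i) = 32 * C1 / (1 - p) * R"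
      using p by (simp add: suminf_mult suminf_geometric summable_geometric)
    also have "(\<Sum>i. R * a3 i) = suminf a3 * R"
      using sum3 by (simp add: suminf_mult)
    also have "ennreal (V * (C1 / (1 - q) * R)) + (ennreal (V * (32 * C1 / (1 - p) * R)) + ennreal (V * (suminf a3 * R))) = ennreal (C * R)"
      using V C1 p q R suminf_nonneg[OF sum3 a3]
      by (simp add: C_def ennreal_plus[symmetric] algebra_simps del: ennreal_plus)
    finally show ?thesis by (simp add: R_def)
  qed
  ultimately show ?thesis by (rule that)
qed

end


section \<open>Tools: a power inequality, paraboloids as test functions, the symmetry between u and
  -u\<close>

text \<open>Weighted Young inequality for T^\<sigma> and 1 with weights \<gamma>/\<sigma> and 1 -
  \<gamma>/\<sigma>. It extracts the small factor \<gamma>/\<sigma> from the exterior growth while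
  the power \<sigma> stays fixed, so that the integral to be estimated does not depend on
  \<gamma>.\<close>

lemma powr_minus_one_le:
  fixes T :: real
  assumes "1 \<le> T" "0 < \<gamma>" "\<gamma> \<le> \<sigma>"
  shows "T powr \<gamma> - 1 \<le> \<gamma> / \<sigma> * T powr \<sigma>"
proof -
  have "(T powr \<sigma>) powr (\<gamma> / \<sigma>) * 1 powr (1 - \<gamma> / \<sigma>) \<le> \<gamma> / \<sigma> * T powr \<sigma> + (1 - \<gamma> / \<sigma>) * 1"
    using assms by (intro Youngs_inequality_0) auto
  then have "T powr \<gamma> \<le> \<gamma> / \<sigma> * T powr \<sigma> + (1 - \<gamma> / \<sigma>)"
    using assms by (simp add: powr_powr)
  moreover have "0 \<le> \<gamma> / \<sigma>" using assms by simp
  ultimately show ?thesis by linarith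
qed

lemma C2_quadratic:
  fixes x0 :: "'a::euclidean_space"
  shows "C2 (\<lambda>x. c + a * (norm (x - x0))\<^sup>2)"
  unfolding C2_def
proof (intro exI conjI allI)
  let ?f' = "\<lambda>x. (2 * a) *\<^sub>R blinfun_inner_left (x - x0)"
  let ?f'' = "\<lambda>x::'a. (2 * a) *\<^sub>R Blinfun (blinfun_inner_left :: 'a \<Rightarrow> 'a \<Rightarrow>\<^sub>L real)"
  have bl: "bounded_linear (blinfun_inner_left :: 'a \<Rightarrow> 'a \<Rightarrow>\<^sub>L real)"
    by (rule bounded_linear_blinfun_inner_left)
  fix x :: 'a
  have eq: "(\<lambda>x. c + a * (norm (x - x0))\<^sup>2) = (\<lambda>x. c + a * inner (x - x0) (x - x0))"
    by (simp add: power2_norm_eq_inner)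
  show "((\<lambda>x. c + a * (norm (x - x0))\<^sup>2) has_derivative blinfun_apply (?f' x)) (at x)"
    unfolding eq
    by (auto intro!: derivative_eq_intros simp: inner_commute algebra_simps scaleR_blinfun.rep_eq blinfun_inner_left.rep_eq)
  have "(blinfun_inner_left has_derivative (blinfun_inner_left :: 'a \<Rightarrow> 'a \<Rightarrow>\<^sub>L real)) (at (x - x0))"
    by (rule bounded_linear_imp_has_derivative[OF bl])
  then have "((\<lambda>x. blinfun_inner_left (x - x0)) has_derivative (blinfun_inner_left :: 'a \<Rightarrow> 'a \<Rightarrow>\<^sub>L real)) (at x)"
    by (rule has_derivative_compose[rotated, where g=blinfun_inner_left, simplified]) (auto intro!: derivative_eq_intros)
  then have "(?f' has_derivative (\<lambda>h. (2 * a) *\<^sub>R blinfun_inner_left h)) (at x)"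
    by (rule has_derivative_scaleR_right)
  then show "(?f' has_derivative blinfun_apply (?f'' x)) (at x)"
    by (simp add: scaleR_blinfun.rep_eq bounded_linear_Blinfun_apply[OF bl])
next
  show "continuous_on UNIV (\<lambda>x::'a. (2 * a) *\<^sub>R Blinfun (blinfun_inner_left :: 'a \<Rightarrow> 'a \<Rightarrow>\<^sub>L real))"
    by (rule continuous_on_const)
qed

lemma C2_minus:
  fixes \<psi> :: "'a::real_normed_vector \<Rightarrow> real"
  assumes "C2 \<psi>"
  shows "C2 (\<lambda>x. - \<psi> x)"
proof -
  from assms obtain f' :: "'a \<Rightarrow> 'a \<Rightarrow>\<^sub>L real" and f'' where
    f: "\<And>x. (\<psi> has_derivative blinfun_apply (f' x)) (at x)"
       "\<And>x. (f' has_derivative blinfun_apply (f'' x)) (at x)" "continuous_on UNIV f''"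
    unfolding C2_def by blast
  show ?thesis
    unfolding C2_def
  proof (intro exI[of _ "\<lambda>x. - f' x"] exI[of _ "\<lambda>x. - f'' x"] conjI allI)
    show "((\<lambda>x. - \<psi> x) has_derivative blinfun_apply (- f' x)) (at x)" for x
      using has_derivative_minus[OF f(1)[of x]] by (simp add: uminus_blinfun.rep_eq)
    show "((\<lambda>x. - f' x) has_derivative blinfun_apply (- f'' x)) (at x)" for x
      using has_derivative_minus[OF f(2)[of x]] by (simp add: uminus_blinfun.rep_eq)
    show "continuous_on UNIV (\<lambda>x. - f'' x)"
      using f(3) by (rule continuous_on_minus)
  qed
qed

text \<open>Negation swaps the positive and negative parts of the second difference. The identity
  survives for non-integrable integrands, where both integrals have the default value 0.\<close>

lemma extremal_max_minus:
  "extremal_max lam Lam \<alpha> \<phi> (\<lambda>x. - u x) x = - extremal_min lam Lam \<alpha> \<phi> u x"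
proof -
  have "second_diff (\<lambda>x. - u x) x y = - second_diff u x y" for y
    by (simp add: second_diff_def)
  then show ?thesis
    unfolding extremal_max_def extremal_min_def second_diff_pos_def second_diff_neg_def
    by (subst Bochner_Integration.integral_minus[symmetric]) simp
qed

text \<open>Turns supersolutions into subsolutions, so that the one-sided
  \<open>oscillation_step\<close> also serves to raise the infimum.\<close>

lemma viscosity_ge_minus:
  assumes "viscosity_le (extremal_min lam Lam \<alpha> \<phi>) \<Omega> u (\<lambda>_. C0)"
  shows "viscosity_ge (extremal_max lam Lam \<alpha> \<phi>) \<Omega> (\<lambda>x. - u x) (\<lambda>_. - C0)"
  unfolding viscosity_ge_def
proof (intro conjI ballI allI impI)
  show "open \<Omega>" using assms by (simp add: viscosity_le_def)
  show "bounded (range (\<lambda>x. - u x))"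
    using assms bounded_uminus[of "range u"] by (simp add: viscosity_le_def image_image)
  have "lsc_on (closure \<Omega>) u" using assms by (simp add: viscosity_le_def)
  then show "usc_on (closure \<Omega>) (\<lambda>x. - u x)"
    unfolding lsc_on_def usc_on_def
  proof (intro ballI allI impI)
    fix x a assume l: "\<forall>x\<in>closure \<Omega>. \<forall>a<u x. \<forall>\<^sub>F y in at x within closure \<Omega>. a < u y"
      and "x \<in> closure \<Omega>" "- u x < a"
    then have "\<forall>\<^sub>F y in at x within closure \<Omega>. - a < u y" by auto
    then show "\<forall>\<^sub>F y in at x within closure \<Omega>. - u y < a" by eventually_elim auto
  qed
next
  fix x N \<psi>
  assume "x \<in> \<Omega>" and *: "open N \<and> x \<in> N \<and> compact (closure N) \<and> closure N \<subseteq> \<Omega> \<and>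
    C2 \<psi> \<and> (\<forall>y\<in>N. - u y \<le> \<psi> y) \<and> \<psi> x = - u x"
  moreover from * have "C2 (\<lambda>x. - \<psi> x) \<and> (\<forall>y\<in>N. - \<psi> y \<le> u y) \<and> - \<psi> x = u x"
    by (auto intro: C2_minus simp: minus_le_iff)
  ultimately have "extremal_min lam Lam \<alpha> \<phi> (\<lambda>y. if y \<in> N then - \<psi> y else u y) x \<le> C0"
    using assms unfolding viscosity_le_def by blast
  moreover have "(\<lambda>y. if y \<in> N then \<psi> y else - u y) = (\<lambda>y. - (if y \<in> N then - \<psi> y else u y))"
    by auto
  ultimately show "- C0 \<le> extremal_max lam Lam \<alpha> \<phi> (\<lambda>y. if y \<in> N then \<psi> y else - u y) x"
    by (simp add: extremal_max_minus)
qed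

section \<open>Improvement of the oscillation at one scale\<close>

context extremal_kernel
begin

lemma kernel_weight_integral:
  obtains C where "0 < C"
    "\<And>r. 0 < r \<Longrightarrow> r \<le> 1/2 \<Longrightarrow> integrable lebesgue (\<lambda>y::'a::euclidean_space. upper_kernel y * weight r y)"
    "\<And>r. 0 < r \<Longrightarrow> r \<le> 1/2 \<Longrightarrow> (LINT y::'a|lebesgue. upper_kernel y * weight r y) \<le> C * r powr (- \<alpha>)"
proof -
  obtain C where C: "0 < C"
    "\<And>r. 0 < r \<Longrightarrow> r \<le> 1/2 \<Longrightarrow>
      (\<integral>\<^sup>+y. upper_kernel y * weight r y \<partial>(lebesgue :: 'a measure)) \<le> ennreal (C * r powr (- \<alpha>))"
    using nn_integral_kernel_weight by blast
  show ?thesis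
  proof (rule that[OF C(1)])
    fix r :: real assume r: "0 < r" "r \<le> 1/2"
    show "integrable lebesgue (\<lambda>y::'a. upper_kernel y * weight r y)"
      using C(2)[OF r] upper_kernel_nonneg weight_nonneg
      by (intro integrableI_nonneg AE_I2 mult_nonneg_nonneg) (auto intro: le_less_trans)
    show "(LINT y::'a|lebesgue. upper_kernel y * weight r y) \<le> C * r powr (- \<alpha>)"
      using C r by (intro integral_real_bounded) auto
  qed
qed

definition lower_kernel :: "'a::euclidean_space \<Rightarrow> real" where
  "lower_kernel y = lam / norm y ^ DIM('a) * ((2 - \<alpha>) / norm y powr \<alpha>)"

lemma measurable_lower_kernel [measurable]: "(lower_kernel :: 'a::euclidean_space \<Rightarrow> real) \<in> borel_measurable lebesgue"
  unfolding lower_kernel_def[abs_def] by measurable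

lemma lower_kernel_nonneg: "0 \<le> lower_kernel y"
  using lam_pos alpha_less by (simp add: lower_kernel_def)

lemma lower_kernel_le_upper: "lower_kernel y \<le> upper_kernel (y::'a::euclidean_space)"
proof (cases "y = 0")
  case False
  then show ?thesis
    unfolding lower_kernel_def upper_kernel_def using lam_pos lam_le alpha_less phi_pos[of "1 / norm y"]
    by (intro mult_mono divide_right_mono) auto
qed (simp add: upper_kernel_def lower_kernel_def zero_power)

lemma extremal_max_eq:
  fixes x :: "'a::euclidean_space"
  shows "extremal_max lam Lam \<alpha> \<phi> v x =
    (LINT y|lebesgue. max (second_diff v x y) 0 * upper_kernel y - max (- second_diff v x y) 0 * lower_kernel y)"
  unfolding extremal_max_def upper_kernel_def lower_kernel_def second_diff_pos_def second_diff_neg_def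
  by (simp add: algebra_simps)


text \<open>Accounting in units of \<open>M * r powr (- \<alpha>)\<close>: the set where w is below
  m + M/2 gains c, while the paraboloid and the exterior growth cost
  \<open>(4 * \<gamma> / \<alpha> + 2 * \<epsilon>) * C\<close>, at most c/2. The remaining c/2
  exceeds C0, so a point z violating the bound would contradict the viscosity inequality at the
  contact point.\<close>

lemma oscillation_step:
  fixes w :: "'a::euclidean_space \<Rightarrow> real"
  assumes cont: "continuous_on UNIV w" and bdd: "bounded (range w)"
    and visc: "viscosity_ge (extremal_max lam Lam \<alpha> \<phi>) (ball 0 1) w (\<lambda>_. - C0)"
    and x0: "norm x0 < 1/2" and r: "0 < r" "r \<le> 1/2" and M: "0 < M"
    and inside: "\<And>x. x \<in> ball x0 r \<Longrightarrow> w x \<le> m + M"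
    and growth: "\<And>x. w x \<le> m + M * max 1 (min (2 * dist x x0) 1 / r) powr \<gamma>"
    and half: "unit_ball_vol DIM('a) * r ^ DIM('a) / 2 \<le> measure lebesgue {x \<in> ball x0 r. w x \<le> m + M / 2}"
    and gamma: "0 < \<gamma>" "\<gamma> \<le> \<alpha> / 2" and eps: "0 < \<epsilon>" "5 powr \<gamma> + \<epsilon> \<le> 5/4"
    and int: "integrable lebesgue (\<lambda>y::'a. upper_kernel y * weight r y)"
      "(LINT y::'a|lebesgue. upper_kernel y * weight r y) \<le> C * r powr (- \<alpha>)"
    and c: "c = unit_ball_vol DIM('a) * lam * (2 - \<alpha>) / (16 * 2 ^ DIM('a) * 2 powr \<alpha>)"
    and small: "(4 * \<gamma> / \<alpha> + 2 * \<epsilon>) * C \<le> c / 2"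
    and C0: "C0 < M * r powr (- \<alpha>) * (c / 2)"
    and z: "z \<in> ball x0 (r / 2)"
  shows "w z \<le> m + (1 - \<epsilon> / 4) * M"
proof (rule ccontr)
  assume contra: "\<not> w z \<le> m + (1 - \<epsilon> / 4) * M"
  \<comment> \<open>Touch \<open>w\<close> from above by a paraboloid centred at \<open>x0\<close>; the contact point \<open>x1\<close> stays inside.\<close>
  define h where "h x = w x - \<epsilon> * M / r\<^sup>2 * (norm (x - x0))\<^sup>2" for x
  have eM: "0 < \<epsilon> * M / r\<^sup>2" using eps M r by simp
  have cont_h: "continuous_on S h" for S
    unfolding h_def using continuous_on_subset[OF cont, of S] by (intro continuous_intros) auto
  obtain x1 where x1: "x1 \<in> cball x0 (3/4 * r)" and max: "\<And>x. x \<in> cball x0 (3/4 * r) \<Longrightarrow> h x \<le> h x1"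
    using continuous_attains_sup[OF compact_cball _ cont_h, of x0 "3/4 * r"] r by auto
  have "z \<in> cball x0 (3/4 * r)" using z r by auto
  then have "h z \<le> h x1" by (rule max)
  \<comment> \<open>The violation at z leaves a deficit of \<epsilon> M / 4, and the paraboloid
    costs at most another \<epsilon> M / 4 within radius r/2.\<close>
  moreover have "m + M * (1 - \<epsilon> / 2) < h z"
  proof -
    have "norm (z - x0) \<le> r / 2" using z by (simp add: dist_norm norm_minus_commute)
    then have "(norm (z - x0))\<^sup>2 \<le> (r / 2)\<^sup>2" by (intro power_mono) auto
    then have "\<epsilon> * M / r\<^sup>2 * (norm (z - x0))\<^sup>2 \<le> \<epsilon> * M / r\<^sup>2 * (r / 2)\<^sup>2"
      using eM by (intro mult_left_mono) auto
    also have "\<dots> = \<epsilon> * M / 4" using r by (simp add: power2_eq_square)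
    finally have "\<epsilon> * M / r\<^sup>2 * (norm (z - x0))\<^sup>2 \<le> \<epsilon> * M / 4" .
    moreover have "m + M * (1 - \<epsilon> / 2) = m + (1 - \<epsilon> / 4) * M - \<epsilon> * M / 4"
      by (simp add: algebra_simps)
    ultimately show ?thesis using contra unfolding h_def by linarith
  qed
  ultimately have hx1: "m + M * (1 - \<epsilon> / 2) < h x1" by simp
  \<comment> \<open>From radius 3r/4 on the paraboloid has risen by at least 9/16 \<epsilon> M, more
    than the deficit 1/2 \<epsilon> M allowed by z. So the maximum is interior, and it is a maximum
    over all of \<open>ball x0 r\<close>.\<close>
  have outer: "h x \<le> m + M * (1 - \<epsilon> / 2)" if "x \<in> ball x0 r" "3/4 * r \<le> norm (x - x0)" for x
  proof -
    have "(3/4 * r)\<^sup>2 \<le> (norm (x - x0))\<^sup>2" using that r by (intro power_mono) auto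
    then have "\<epsilon> * M / r\<^sup>2 * (3/4 * r)\<^sup>2 \<le> \<epsilon> * M / r\<^sup>2 * (norm (x - x0))\<^sup>2"
      using eM by (intro mult_left_mono) auto
    moreover have "\<epsilon> * M / r\<^sup>2 * (3/4 * r)\<^sup>2 = 9/16 * (\<epsilon> * M)" using r by (simp add: power2_eq_square)
    moreover have "0 < \<epsilon> * M" using eps M by simp
    moreover have "m + M * (1 - \<epsilon> / 2) = m + M - 1/2 * (\<epsilon> * M)"
      by (simp add: algebra_simps)
    ultimately show ?thesis using inside[OF that(1)] unfolding h_def by linarith
  qed
  have x1r: "norm (x1 - x0) < 3/4 * r"
  proof (rule ccontr)
    assume "\<not> norm (x1 - x0) < 3/4 * r"
    moreover have "x1 \<in> ball x0 r" using x1 r by auto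
    ultimately show False using outer[of x1] hx1 by simp
  qed
  have hmax: "h x \<le> h x1" if "x \<in> ball x0 r" for x
    using outer[OF that] max[of x] hx1 by (force simp: dist_norm norm_minus_commute)
  have wx1: "m + M * (1 - \<epsilon> / 2) < w x1"
    using hx1 mult_nonneg_nonneg[OF less_imp_le[OF eM], of "(norm (x1 - x0))\<^sup>2"] by (simp add: h_def)

  \<comment> \<open>Since x1 is within 3r/4 of x0, the radius r/4 keeps N in
    \<open>ball x0 r\<close>, where the paraboloid lies above w. With |x0| < 1/2 and r at most 1/2,
    the closure of N also stays in the unit ball.\<close>
  define N where "N = ball x1 (r / 4)"
  define \<psi> where "\<psi> = (\<lambda>x. h x1 + \<epsilon> * M / r\<^sup>2 * (norm (x - x0))\<^sup>2)"
  define v where "v = (\<lambda>y. if y \<in> N then \<psi> y else w y)"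
  have x10: "dist x0 x1 < 3/4 * r" using x1r by (simp add: dist_norm norm_minus_commute)
  have N_sub: "N \<subseteq> ball x0 r"
  proof
    fix y assume "y \<in> N"
    then have "dist x1 y < r / 4" by (simp add: N_def)
    with x10 show "y \<in> ball x0 r" using dist_triangle[of x0 y x1] by simp
  qed
  have closure_N: "closure N = cball x1 (r / 4)" using r by (simp add: N_def)
  have "-C0 \<le> extremal_max lam Lam \<alpha> \<phi> v x1"
  proof -
    have "cball x1 (r / 4) \<subseteq> ball 0 1"
    proof
      fix y assume "y \<in> cball x1 (r / 4)"
      then have "dist x1 y \<le> r / 4" by simp
      with x10 x0 r show "y \<in> ball 0 1"
        using dist_triangle[of x0 y x1] dist_triangle[of 0 y x0] by simp
    qed
    moreover have "x1 \<in> ball 0 1"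
      using x10 x0 r dist_triangle[of 0 x1 x0] by simp
    moreover have "C2 \<psi>" unfolding \<psi>_def by (rule C2_quadratic)
    moreover have "\<forall>y\<in>N. w y \<le> \<psi> y"
      using hmax N_sub by (force simp: \<psi>_def h_def)
    moreover have "\<psi> x1 = w x1" by (simp add: \<psi>_def h_def)
    moreover have "open N" "x1 \<in> N" using r by (auto simp: N_def)
    ultimately show ?thesis
      unfolding v_def
      by (intro visc[unfolded viscosity_ge_def, THEN conjunct2, THEN conjunct2, THEN conjunct2,
            THEN bspec, THEN spec, THEN spec, THEN mp] conjI)
        (simp_all add: closure_N)
  qed

  define \<delta> where "\<delta> = second_diff v x1"
  define D where "D = M * (4 * \<gamma> / \<alpha> + 2 * \<epsilon>)"
  have D: "0 \<le> D" using M gamma eps alpha_pos by (simp add: D_def)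
  have x1N: "v x1 = w x1" using r by (simp add: v_def N_def \<psi>_def h_def)
  \<comment> \<open>By the parallelogram law the second difference of a paraboloid does not depend
    on the base point.\<close>
  have near: "\<delta> y = 2 * \<epsilon> * M * weight r y" if "norm y < r / 4" for y
  proof -
    have "x1 + y \<in> N" "x1 - y \<in> N" "x1 \<in> N" using that r by (auto simp: N_def dist_norm)
    then have "\<delta> y = \<psi> (x1 + y) + \<psi> (x1 - y) - 2 * \<psi> x1"
      by (simp add: \<delta>_def second_diff_def v_def)
    also have "\<dots> = \<epsilon> * M / r\<^sup>2 * ((norm (x1 + y - x0))\<^sup>2 + (norm (x1 - y - x0))\<^sup>2 - 2 * (norm (x1 - x0))\<^sup>2)"
      unfolding \<psi>_def right_diff_distrib distrib_left by simp
    also have "(norm (x1 + y - x0))\<^sup>2 + (norm (x1 - y - x0))\<^sup>2 - 2 * (norm (x1 - x0))\<^sup>2 = 2 * (norm y)\<^sup>2"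
    proof -
      define a where "a = x1 - x0"
      have eqs: "x1 + y - x0 = a + y" "x1 - y - x0 = a - y" "x1 - x0 = a" by (simp_all add: a_def)
      show ?thesis
        unfolding eqs
        by (simp add: power2_norm_eq_inner inner_add_left inner_add_right inner_diff_left inner_diff_right
            inner_commute[of y a])
    qed
    finally show ?thesis using that by (simp add: weight_def power_divide)
  qed
  have far_eq: "\<delta> y = w (x1 + y) + w (x1 - y) - 2 * w x1" if "r / 4 \<le> norm y" for y
    using that x1N by (simp add: \<delta>_def second_diff_def v_def N_def dist_norm)
  have weight_ge1: "1 \<le> weight r y" if "r / 4 \<le> norm y" for y :: 'a
    using that r alpha_pos by (auto simp: weight_def min_def field_simps intro!: ge_one_powr_ge_zero)
  \<comment> \<open>Here |y| is at least r/4, so x1 + y and x1 - y are within 4|y| of x0; this is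
    the origin of the 8 in \<open>weight\<close>. The lower bound \<open>wx1\<close> cancels m + M
    and leaves T^\<gamma> - 1 together with an \<epsilon>.\<close>
  have far: "\<delta> y \<le> D * weight r y" if y: "r / 4 \<le> norm y" for y
  proof -
    define T where "T = min (8 * norm y) 1 / r"
    have T: "1 \<le> T" using y r by (auto simp: T_def min_def field_simps)
    have W: "weight r y = T powr (\<alpha> / 2)" using y by (simp add: weight_def T_def)
    have *: "w x \<le> m + M * T powr \<gamma>" if "dist x x1 = norm y" for x
    proof -
      have "dist x x0 \<le> 4 * norm y"
        using x10 y that dist_triangle[of x x0 x1] by (simp add: dist_commute)
      then have "min (2 * dist x x0) 1 / r \<le> T"
        using r by (auto simp: T_def intro!: divide_right_mono)
      then have "max 1 (min (2 * dist x x0) 1 / r) powr \<gamma> \<le> T powr \<gamma>"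
        using T gamma by (intro powr_mono2) auto
      then have "M * max 1 (min (2 * dist x x0) 1 / r) powr \<gamma> \<le> M * T powr \<gamma>"
        using M by (intro mult_left_mono) auto
      then show ?thesis using growth[of x] by linarith
    qed
    have "\<delta> y \<le> 2 * (m + M * T powr \<gamma>) - 2 * (m + M * (1 - \<epsilon> / 2))"
      using *[of "x1 + y"] *[of "x1 - y"] wx1 far_eq[OF y] by (simp add: dist_norm)
    also have "\<dots> = M * (2 * (T powr \<gamma> - 1) + \<epsilon>)" by (simp add: algebra_simps)
    also have "\<dots> \<le> M * (2 * (\<gamma> / (\<alpha> / 2) * T powr (\<alpha> / 2)) + \<epsilon> * T powr (\<alpha> / 2))"
    proof (intro mult_left_mono add_mono)
      show "T powr \<gamma> - 1 \<le> \<gamma> / (\<alpha> / 2) * T powr (\<alpha> / 2)"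
        using T gamma by (rule powr_minus_one_le)
      show "\<epsilon> \<le> \<epsilon> * T powr (\<alpha> / 2)"
        using weight_ge1[OF y] eps by (simp add: W)
    qed (use M in auto)
    also have "\<dots> \<le> D * weight r y"
      using M eps by (simp add: D_def W algebra_simps)
    finally show ?thesis .
  qed
  have delta_le: "\<delta> y \<le> D * weight r y" for y
  proof (cases "norm y < r / 4")
    case True
    have "2 * \<epsilon> * M * weight r y \<le> D * weight r y"
      using weight_nonneg[of r y] M gamma alpha_pos by (intro mult_right_mono) (auto simp: D_def algebra_simps)
    then show ?thesis using near[OF True] by simp
  qed (simp add: far)

  \<comment> \<open>Displacements below r/4 are excluded because there v is the paraboloid and not
    w.\<close>
  define A where "A = {y. x1 + y \<in> ball x0 r \<and> w (x1 + y) \<le> m + M / 2 \<and> r / 4 \<le> norm y}"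
  have norm_A: "norm y < 2 * r" if "y \<in> A" for y
  proof -
    have "dist x0 (x1 + y) < r" using that by (simp add: A_def)
    then have "dist x1 (x1 + y) < 2 * r"
      using x10 r dist_triangle[of x1 "x1 + y" x0] by (simp add: dist_commute)
    then show ?thesis by (simp add: dist_norm)
  qed
  \<comment> \<open>x1 + y is in the low half, and the reflected point x1 - y is within 7r/4 + 3r/4
    = 5r/2 of x0. Doubled by the growth bound this gives the base 5 in
    \<open>5 powr \<gamma> + \<epsilon> \<le> 5/4\<close>; the latter leaves 5/4 - 3/2 =
    -1/4.\<close>
  have delta_A: "\<delta> y \<le> - M / 4" if y: "y \<in> A" for y
  proof -
    have "dist x0 (x1 + y) < r" using y by (simp add: A_def)
    then have "norm y < 7/4 * r"
      using x10 r dist_triangle[of x1 "x1 + y" x0] by (simp add: dist_commute dist_norm)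
    then have "dist (x1 - y) x0 \<le> 5/2 * r"
      using x10 dist_triangle[of "x1 - y" x0 x1] by (simp add: dist_commute dist_norm)
    then have "min (2 * dist (x1 - y) x0) 1 / r \<le> 5"
      using r by (auto simp: field_simps min_def)
    then have "max 1 (min (2 * dist (x1 - y) x0) 1 / r) powr \<gamma> \<le> 5 powr \<gamma>"
      using gamma by (intro powr_mono2) auto
    then have "M * max 1 (min (2 * dist (x1 - y) x0) 1 / r) powr \<gamma> \<le> M * 5 powr \<gamma>"
      using M by (intro mult_left_mono) auto
    then have "w (x1 - y) \<le> m + M * 5 powr \<gamma>" using growth[of "x1 - y"] by linarith
    moreover have "w (x1 + y) \<le> m + M / 2" using y by (auto simp: A_def)
    moreover have "\<delta> y = w (x1 + y) + w (x1 - y) - 2 * w x1"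
      using y by (intro far_eq) (simp add: A_def)
    ultimately have "\<delta> y \<le> (m + M / 2) + (m + M * 5 powr \<gamma>) - 2 * (m + M * (1 - \<epsilon> / 2))"
      using wx1 by (simp only:) (intro diff_mono add_mono mult_left_mono; simp)
    also have "\<dots> = M * (5 powr \<gamma> + \<epsilon> - 3/2)" by (simp add: algebra_simps)
    also have "\<dots> \<le> M * (- 1/4)" using M eps by (intro mult_left_mono) auto
    finally show ?thesis by simp
  qed
  \<comment> \<open>The loss M/4 from \<open>delta_A\<close> times the radially decreasing lower
    kernel at radius 2r, beyond which A does not reach.\<close>
  define b where "b = M / 4 * (lam / (2 * r) ^ DIM('a) * ((2 - \<alpha>) / (2 * r) powr \<alpha>))"
  have b: "0 \<le> b" using M lam_pos alpha_less r by (simp add: b_def)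
  let ?F = "\<lambda>y. max (\<delta> y) 0 * upper_kernel y - max (- \<delta> y) 0 * lower_kernel y"
  have F_le: "?F y \<le> D * (upper_kernel y * weight r y) - b * indicator A y" for y
  proof (cases "y \<in> A")
    case True
    have y: "0 < norm y" using True r by (auto simp: A_def)
    have d: "\<delta> y \<le> - M / 4" by (rule delta_A[OF True])
    have "lam / (2 * r) ^ DIM('a) * ((2 - \<alpha>) / (2 * r) powr \<alpha>) \<le> lower_kernel y"
      unfolding lower_kernel_def using norm_A[OF True] y lam_pos alpha_less alpha_pos r
      by (intro mult_mono divide_left_mono power_mono powr_mono2 mult_pos_pos zero_less_power) auto
    then have "b \<le> max (- \<delta> y) 0 * lower_kernel y"
      unfolding b_def using d M r lam_pos alpha_less by (intro mult_mono) auto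
    moreover have "0 \<le> D * (upper_kernel y * weight r y)"
      using D upper_kernel_nonneg[of y] weight_nonneg[of r y] by simp
    ultimately show ?thesis using True d M by simp
  next
    case False
    have "max (\<delta> y) 0 * upper_kernel y \<le> (D * weight r y) * upper_kernel y"
      using delta_le[of y] D weight_nonneg[of r y] upper_kernel_nonneg[of y] by (intro mult_right_mono) auto
    moreover have "0 \<le> max (- \<delta> y) 0 * lower_kernel y" using lower_kernel_nonneg[of y] by simp
    ultimately show ?thesis using False by (simp add: algebra_simps)
  qed

  obtain B where B: "\<And>x. \<bar>w x\<bar> \<le> B"
    using bdd unfolding bounded_iff by auto
  have "0 \<le> B" using B[of 0] by linarith
  have v_meas: "v \<in> borel_measurable borel"
  proof -
    have "continuous_on UNIV \<psi>" unfolding \<psi>_def by (intro continuous_intros)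
    then have [measurable]: "\<psi> \<in> borel_measurable borel" "w \<in> borel_measurable borel"
      using cont by (auto intro: borel_measurable_continuous_onI)
    have [measurable]: "N \<in> sets borel" by (simp add: N_def)
    show ?thesis unfolding v_def by measurable
  qed
  have delta_meas [measurable]: "\<delta> \<in> borel_measurable lebesgue"
  proof (rule borel_imp_lebesgue)
    note v_meas [measurable]
    show "\<delta> \<in> borel_measurable borel"
      unfolding \<delta>_def second_diff_def[abs_def] by measurable
  qed
  \<comment> \<open>Needed for monotonicity of the Bochner integral, as the default value 0 would
    spoil the upper bound. The bound B of w is used for this only and does not enter the
    estimate.\<close>
  have "integrable lebesgue ?F"
  proof (rule Bochner_Integration.integrable_bound)
    show "integrable lebesgue (\<lambda>y::'a. (2 * \<epsilon> * M + 4 * B) * (upper_kernel y * weight r y))"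
      using int(1) by (rule integrable_mult_right)
    show "?F \<in> borel_measurable lebesgue" by measurable
    show "AE y in lebesgue. norm (?F y) \<le> norm ((2 * \<epsilon> * M + 4 * B) * (upper_kernel y * weight r y))"
    proof (rule AE_I2)
      fix y :: 'a
      have "\<bar>\<delta> y\<bar> \<le> (2 * \<epsilon> * M + 4 * B) * weight r y"
      proof (cases "norm y < r / 4")
        case True
        then show ?thesis
          using near[OF True] weight_nonneg[of r y] eps M \<open>0 \<le> B\<close> by (simp add: algebra_simps)
      next
        case False
        then have y: "r / 4 \<le> norm y" by simp
        have "\<bar>\<delta> y\<bar> \<le> 4 * B"
          using far_eq[OF y] B[of "x1 + y"] B[of "x1 - y"] B[of x1] by linarith
        also have "\<dots> \<le> (2 * \<epsilon> * M + 4 * B) * weight r y"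
          using weight_ge1[OF y] eps M \<open>0 \<le> B\<close> mult_mono[of "4 * B" "2 * \<epsilon> * M + 4 * B" 1 "weight r y"] by simp
        finally show ?thesis .
      qed
      then have "\<bar>\<delta> y\<bar> * upper_kernel y \<le> (2 * \<epsilon> * M + 4 * B) * weight r y * upper_kernel y"
        using upper_kernel_nonneg[of y] by (intro mult_right_mono) auto
      moreover have "norm (?F y) \<le> \<bar>\<delta> y\<bar> * upper_kernel y"
        using lower_kernel_le_upper[of y] lower_kernel_nonneg[of y] upper_kernel_nonneg[of y]
        by (cases "0 \<le> \<delta> y") (auto simp: max_def abs_mult intro!: mult_left_mono)
      moreover have "0 \<le> (2 * \<epsilon> * M + 4 * B) * (upper_kernel y * weight r y)"
        using upper_kernel_nonneg[of y] weight_nonneg[of r y] eps M \<open>0 \<le> B\<close> by simp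
      ultimately show "norm (?F y) \<le> norm ((2 * \<epsilon> * M + 4 * B) * (upper_kernel y * weight r y))"
        by (simp add: algebra_simps)
    qed
  qed

  let ?G = "{x \<in> ball x0 r. w x \<le> m + M / 2}"
  have w_meas [measurable]: "w \<in> borel_measurable borel"
    using cont by (rule borel_measurable_continuous_onI)
  have [measurable]: "ball x0 r \<in> sets borel" by simp
  have "A \<in> sets borel" unfolding A_def by measurable
  then have A_sets: "A \<in> sets lebesgue" by simp
  have "A \<subseteq> ball 0 (2 * r)" using norm_A by auto
  then have A_fin: "A \<in> lmeasurable"
    using A_sets lmeasurable_ball by (rule fmeasurableI2[rotated 1]) 
  \<comment> \<open>Removing the ball of radius r/4 costs at most a quarter of the volume of
    \<open>ball x0 r\<close>, since the dimension is at least 1; of the half, a quarter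
    remains.\<close>
  have A_measure: "unit_ball_vol DIM('a) * r ^ DIM('a) / 4 \<le> measure lebesgue A"
  proof -
    have sub: "?G \<subseteq> (+) x1 ` A \<union> ball x1 (r / 4)"
    proof
      fix x assume x: "x \<in> ?G"
      show "x \<in> (+) x1 ` A \<union> ball x1 (r / 4)"
      proof (cases "dist x1 x < r / 4")
        case False
        then have "x - x1 \<in> A" using x by (simp add: A_def dist_norm norm_minus_commute)
        then show ?thesis by (auto intro!: image_eqI[where x="x - x1"])
      qed simp
    qed
    have A1: "(+) x1 ` A \<in> lmeasurable" using A_fin by (rule measurable_translation)
    have "?G \<in> sets borel" by measurable
    then have "measure lebesgue ?G \<le> measure lebesgue ((+) x1 ` A \<union> ball x1 (r / 4))"
      using A1 by (intro measure_mono_fmeasurable[OF sub] fmeasurable.Un) auto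
    also have "\<dots> \<le> measure lebesgue ((+) x1 ` A) + measure lebesgue (ball x1 (r / 4))"
      using A1 by (intro measure_Un_le) auto
    also have "measure lebesgue ((+) x1 ` A) = measure lebesgue A"
      by (rule measure_translation)
    also have "measure lebesgue (ball x1 (r / 4)) = unit_ball_vol DIM('a) * r ^ DIM('a) * (1/4) ^ DIM('a)"
      using r by (simp add: content_ball power_divide)
    also have "\<dots> \<le> unit_ball_vol DIM('a) * r ^ DIM('a) * (1/4) ^ 1"
      using r DIM_positive[where 'a='a] by (intro mult_left_mono power_decreasing) auto
    finally show ?thesis using half by simp
  qed

  have int_KD: "integrable lebesgue (\<lambda>y::'a. D * (upper_kernel y * weight r y))"
    using int(1) by (rule integrable_mult_right)
  have int_A: "integrable lebesgue (\<lambda>y. b * indicator A y)"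
    using A_fin by (intro integrable_mult_right integrable_real_indicator) (auto simp: fmeasurable_def)
  have "extremal_max lam Lam \<alpha> \<phi> v x1 = (LINT y|lebesgue. ?F y)"
    by (simp add: extremal_max_eq \<delta>_def)
  also have "\<dots> \<le> (LINT y|lebesgue. D * (upper_kernel y * weight r y) - b * indicator A y)"
    using \<open>integrable lebesgue ?F\<close> Bochner_Integration.integrable_diff[OF int_KD int_A] F_le
    by (rule integral_mono)
  also have "\<dots> = D * (LINT y::'a|lebesgue. upper_kernel y * weight r y) - b * measure lebesgue A"
    using A_fin by (subst Bochner_Integration.integral_diff[OF int_KD int_A]) simp
  also have "\<dots> \<le> D * (C * r powr (- \<alpha>)) - b * (unit_ball_vol DIM('a) * r ^ DIM('a) / 4)"
    using int(2) A_measure D b by (intro diff_mono mult_left_mono) auto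
  \<comment> \<open>This is where c comes from: 16 is 4 from \<open>delta_A\<close> times 4 from
    \<open>A_measure\<close>, and the powers of 2 come from evaluating the kernel at 2r.\<close>
  also have "b * (unit_ball_vol DIM('a) * r ^ DIM('a) / 4) = M * r powr (- \<alpha>) * c"
    using r by (simp add: b_def c powr_mult powr_minus power_mult_distrib field_simps)
  also have "D * (C * r powr (- \<alpha>)) = M * r powr (- \<alpha>) * ((4 * \<gamma> / \<alpha> + 2 * \<epsilon>) * C)"
    by (simp add: D_def)
  also have "\<dots> \<le> M * r powr (- \<alpha>) * (c / 2)"
    using small M by (intro mult_left_mono) auto
  finally have "extremal_max lam Lam \<alpha> \<phi> v x1 \<le> M * r powr (- \<alpha>) * (c / 2) - M * r powr (- \<alpha>) * c"
    by simp
  then show False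
    using \<open>-C0 \<le> extremal_max lam Lam \<alpha> \<phi> v x1\<close> C0 by (simp add: algebra_simps)
qed

end


section \<open>The essential supremum, growth across scales, choice of parameters\<close>

text \<open>The set where |u| exceeds its essential supremum is null and, by continuity, open; hence
  it is empty.\<close>

lemma abs_le_Linf_norm:
  fixes u :: "'a::euclidean_space \<Rightarrow> real"
  assumes cont: "continuous_on UNIV u" and bdd: "bounded (range u)"
  shows "\<bar>u x\<bar> \<le> Linf_norm u"
proof -
  obtain B where B: "\<And>x. \<bar>u x\<bar> \<le> B" using bdd unfolding bounded_iff by auto
  have [measurable]: "u \<in> borel_measurable lebesgue"
    using borel_measurable_continuous_onI[OF cont] by (auto intro: measurable_completion)
  let ?E = "esssup lebesgue (\<lambda>x. ereal \<bar>u x\<bar>)"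
  have "?E \<le> ereal B" using B by (intro esssup_I) auto
  have ae: "AE x in lebesgue. ereal \<bar>u x\<bar> \<le> ?E" by (rule esssup_AE)
  \<comment> \<open>Together with the upper bound B this makes the essential supremum a real number,
    so \<open>real_of_ereal\<close> does not fall back on its default value.\<close>
  have "\<exists>x. ereal \<bar>u x\<bar> \<le> ?E"
  proof (rule ccontr)
    assume "\<nexists>x. ereal \<bar>u x\<bar> \<le> ?E"
    with ae have "AE x::'a in lebesgue. False" by simp
    then have "UNIV \<in> null_sets (lebesgue :: 'a measure)"
      by (simp add: completion.AE_iff_null_sets)
    then show False by (metis negligible_iff_null_sets non_negligible_UNIV)
  qed
  then obtain y where "ereal \<bar>u y\<bar> \<le> ?E" by blast
  with \<open>?E \<le> ereal B\<close> obtain e where e: "?E = ereal e"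
    by (cases ?E) auto
  have "open {x. e < \<bar>u x\<bar>}"
    using cont by (intro open_Collect_less continuous_intros) 
  moreover have "negligible {x. e < \<bar>u x\<bar>}"
    using ae unfolding e by (simp add: completion.AE_iff_null_sets negligible_iff_null_sets not_le)
  ultimately have "{x. e < \<bar>u x\<bar>} = {}" by (metis open_not_negligible)
  then show ?thesis unfolding Linf_norm_def e by (auto simp: not_less)
qed

text \<open>The oscillation bound A 2^(-j \<gamma>) holds on radius 2^(-j-1). If x lies between two
  consecutive dyadic radii, the larger radius is at most twice the distance to x0, which explains
  \<open>2 * dist x x0\<close>. At distance 1/2 or more only the global bound A is left, and capping
  the doubled distance at 1 covers it.\<close>

lemma dyadic_growth:
  fixes u :: "'a::metric_space \<Rightarrow> real"
  assumes osc: "\<And>j x y. j \<le> n \<Longrightarrow> x \<in> ball x0 ((1/2) ^ Suc j) \<Longrightarrow> y \<in> ball x0 ((1/2) ^ Suc j) \<Longrightarrow>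
      \<bar>u x - u y\<bar> \<le> A * ((1/2) powr \<gamma>) ^ j"
    and all: "\<And>x y. \<bar>u x - u y\<bar> \<le> A"
    and pos: "0 < \<gamma>" "0 < A" and z: "z \<in> ball x0 ((1/2) ^ Suc n)"
  shows "\<bar>u x - u z\<bar> \<le> A * ((1/2) powr \<gamma>) ^ n * max 1 (min (2 * dist x x0) 1 / (1/2) ^ Suc n) powr \<gamma>"
proof -
  let ?h = "\<lambda>j::nat. (1/2::real) ^ j"
  let ?G = "max 1 (min (2 * dist x x0) 1 / ?h (Suc n))"
  have hp: "((1/2) powr \<gamma>) ^ j = ?h j powr \<gamma>" for j
    by (simp add: powr_power powr_realpow[symmetric] powr_powr mult.commute)
  have reduce: "\<bar>u x - u z\<bar> \<le> A * ((1/2) powr \<gamma>) ^ n * ?G powr \<gamma>"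
    if "\<bar>u x - u z\<bar> \<le> A * ?h j powr \<gamma>" "?h j / ?h n \<le> ?G" for j
  proof -
    have "?h j powr \<gamma> = ?h n powr \<gamma> * (?h j / ?h n) powr \<gamma>"
      by (simp add: powr_mult[symmetric])
    also have "\<dots> \<le> ?h n powr \<gamma> * ?G powr \<gamma>"
      using that(2) pos by (intro mult_left_mono powr_mono2) auto
    finally have "A * ?h j powr \<gamma> \<le> A * (?h n powr \<gamma> * ?G powr \<gamma>)"
      using pos by (intro mult_left_mono) auto
    then show ?thesis using that(1) by (simp add: hp mult.assoc)
  qed
  consider "x \<in> ball x0 (?h (Suc n))" | "x \<notin> ball x0 (?h (Suc n))" "dist x x0 < 1/2" | "1/2 \<le> dist x x0"
    by linarith
  then show ?thesis
  proof cases
    case 1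
    show ?thesis
      by (rule reduce[of n]) (use osc[OF order_refl 1 z] hp in auto)
  next
    case 2
    have d: "?h (Suc n) \<le> dist x x0" using 2 by (simp add: dist_commute)
    have "0 < 2 * dist x x0" using d zero_less_power[of "1/2::real" "Suc n"] by linarith
    moreover have "2 * dist x x0 < 1" using 2 by simp
    ultimately obtain j where j: "?h (Suc j) \<le> 2 * dist x x0" "2 * dist x x0 < ?h j"
      using dyadic_down by blast
    have "?h n < ?h j" using d j(2) unfolding power_Suc by linarith
    then have jn: "j < n" by simp
    have "x \<in> ball x0 (?h (Suc j))" using j by (simp add: dist_commute)
    moreover have "?h (Suc n) \<le> ?h (Suc j)" using jn by (intro power_decreasing) auto
    then have "z \<in> ball x0 (?h (Suc j))" using z unfolding mem_ball by linarith
    ultimately have "\<bar>u x - u z\<bar> \<le> A * ((1/2) powr \<gamma>) ^ j" using jn by (intro osc) auto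
    moreover have "?h j / ?h n \<le> ?G"
    proof -
      have "?h j / ?h n = ?h (Suc j) / ?h (Suc n)" by simp
      also have "\<dots> \<le> 2 * dist x x0 / ?h (Suc n)"
        using j by (intro divide_right_mono) auto
      also have "\<dots> \<le> ?G" using 2 by simp
      finally show ?thesis .
    qed
    ultimately show ?thesis by (intro reduce[of j]) (simp_all add: hp)
  next
    case 3
    show ?thesis
    proof (rule reduce[of 0])
      show "\<bar>u x - u z\<bar> \<le> A * ?h 0 powr \<gamma>" using all[of x z] by simp
      have "?h 0 / ?h n \<le> 1 / ?h (Suc n)" by (intro frac_le) auto
      then show "?h 0 / ?h n \<le> ?G" using 3 by simp
    qed
  qed
qed

text \<open>The two costs share the budget: 2 \<epsilon> C and (4 \<gamma> / \<alpha>) C each get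
  c/4. The last condition ties \<gamma> to \<epsilon>, so \<epsilon> is fixed first and \<gamma> is
  taken near 0, where both powers tend to 1.\<close>

lemma exists_small_parameters:
  fixes C c \<alpha> :: real
  assumes "0 < C" "0 < c" "0 < \<alpha>"
  obtains \<gamma> \<epsilon> where "0 < \<gamma>" "\<gamma> < 1" "\<gamma> \<le> \<alpha> / 2" "0 < \<epsilon>" "5 powr \<gamma> + \<epsilon> \<le> 5/4"
    "(4 * \<gamma> / \<alpha> + 2 * \<epsilon>) * C \<le> c / 2" "1 - \<epsilon> / 4 \<le> (1/2) powr \<gamma>"
proof -
  define \<epsilon> where "\<epsilon> = min (1/8) (c / (8 * C))"
  have e: "0 < \<epsilon>" "\<epsilon> \<le> 1/8" "\<epsilon> \<le> c / (8 * C)" using assms by (auto simp: \<epsilon>_def)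
  have eC: "\<epsilon> * C \<le> c / 8" using e(3) assms by (simp add: field_simps)
  have t: "((\<lambda>\<gamma>. b powr \<gamma>) \<longlongrightarrow> 1) (at_right 0)" if "0 < b" for b :: real
    using that tendsto_powr[OF tendsto_const tendsto_ident_at, of b 0 "{0<..}"] by simp
  have "\<forall>\<^sub>F \<gamma> in at_right (0::real). 5 powr \<gamma> < 9/8"
    by (rule order_tendstoD(2)[OF t]) auto
  moreover have "\<forall>\<^sub>F \<gamma> in at_right (0::real). 1 - \<epsilon> / 4 < (1/2) powr \<gamma>"
    using e by (intro order_tendstoD(1)[OF t]) auto
  moreover have "\<forall>\<^sub>F \<gamma> in at_right (0::real). \<gamma> < min 1 (min (\<alpha> / 2) (c * \<alpha> / (16 * C)))"
    using assms by (intro order_tendstoD(2)[OF tendsto_ident_at]) auto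
  moreover have "\<forall>\<^sub>F \<gamma> in at_right (0::real). 0 < \<gamma>"
    by (simp add: eventually_at_right_less)
  ultimately have "\<forall>\<^sub>F \<gamma> in at_right (0::real). 5 powr \<gamma> < 9/8 \<and> 1 - \<epsilon> / 4 < (1/2) powr \<gamma> \<and>
      \<gamma> < min 1 (min (\<alpha> / 2) (c * \<alpha> / (16 * C))) \<and> 0 < \<gamma>"
    by eventually_elim auto
  then obtain \<gamma> where g: "5 powr \<gamma> < 9/8" "1 - \<epsilon> / 4 < (1/2) powr \<gamma>" "\<gamma> < 1" "\<gamma> < \<alpha> / 2"
      "\<gamma> < c * \<alpha> / (16 * C)" "0 < \<gamma>"
    using eventually_happens'[OF trivial_limit_at_right_real] by (metis (mono_tags, lifting) min_less_iff_conj)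
  have "4 * \<gamma> / \<alpha> * C \<le> c / 4" using g(5) assms by (simp add: field_simps)
  moreover have "(4 * \<gamma> / \<alpha> + 2 * \<epsilon>) * C = 4 * \<gamma> / \<alpha> * C + 2 * (\<epsilon> * C)"
    by (simp add: algebra_simps)
  ultimately have "(4 * \<gamma> / \<alpha> + 2 * \<epsilon>) * C \<le> c / 2" using eC by linarith
  then show ?thesis using e g by (intro that[of \<gamma> \<epsilon>]) auto
qed

section \<open>Geometric decay over dyadic balls and the Hoelder estimate\<close>

context extremal_kernel
begin

text \<open>Strong induction, because the exterior growth at one scale uses the bounds at all
  coarser ones. Radii start at 1/2, which keeps every ball about x0 inside the unit ball, and the
  global bound A settles n = 0.\<close>

lemma oscillation_decay:
  fixes u :: "'a::euclidean_space \<Rightarrow> real"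
  assumes cont: "continuous_on UNIV u" and bdd: "bounded (range u)"
    and ge: "viscosity_ge (extremal_max lam Lam \<alpha> \<phi>) (ball 0 1) u (\<lambda>_. - C0)"
    and le: "viscosity_le (extremal_min lam Lam \<alpha> \<phi>) (ball 0 1) u (\<lambda>_. C0)"
    and x0: "norm x0 < 1/2"
    and gamma: "0 < \<gamma>" "\<gamma> \<le> \<alpha> / 2" and eps: "0 < \<epsilon>" "5 powr \<gamma> + \<epsilon> \<le> 5/4"
    and int: "\<And>r. 0 < r \<Longrightarrow> r \<le> 1/2 \<Longrightarrow> integrable lebesgue (\<lambda>y::'a. upper_kernel y * weight r y)"
      "\<And>r. 0 < r \<Longrightarrow> r \<le> 1/2 \<Longrightarrow> (LINT y::'a|lebesgue. upper_kernel y * weight r y) \<le> C * r powr (- \<alpha>)"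
    and c: "c = unit_ball_vol DIM('a) * lam * (2 - \<alpha>) / (16 * 2 ^ DIM('a) * 2 powr \<alpha>)" "0 < c"
    and small: "(4 * \<gamma> / \<alpha> + 2 * \<epsilon>) * C \<le> c / 2"
    and decay: "1 - \<epsilon> / 4 \<le> (1/2) powr \<gamma>"
    and A: "0 < A" "C0 < A * (c / 2)" and all: "\<And>x y. \<bar>u x - u y\<bar> \<le> A"
    and xy: "x \<in> ball x0 ((1/2) ^ Suc n)" "y \<in> ball x0 ((1/2) ^ Suc n)"
  shows "\<bar>u x - u y\<bar> \<le> A * ((1/2) powr \<gamma>) ^ n"
  using xy
proof (induction n arbitrary: x y rule: less_induct)
  case (less i)
  show ?case
  proof (cases i)
    case 0
    then show ?thesis using all[of x y] by simp
  next
    case (Suc n)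
    define r where "r = (1/2::real) ^ Suc n"
    define M where "M = A * ((1/2) powr \<gamma>) ^ n"
    define G where "G x = max 1 (min (2 * dist x x0) 1 / r) powr \<gamma>" for x
    have r: "0 < r" "r \<le> 1/2" using power_decreasing[of 0 n "1/2::real"] by (auto simp: r_def)
    have M: "0 < M" using A by (simp add: M_def)
    have IH: "\<bar>u x - u y\<bar> \<le> A * ((1/2) powr \<gamma>) ^ j"
      if "j \<le> n" "x \<in> ball x0 ((1/2) ^ Suc j)" "y \<in> ball x0 ((1/2) ^ Suc j)" for j x y
      using less.IH[of j x y] that Suc by simp
    have osc: "\<bar>u x - u y\<bar> \<le> M" if "x \<in> ball x0 r" "y \<in> ball x0 r" for x y
      using IH[of n x y] that by (simp add: M_def r_def)
    have growth: "\<bar>u x - u z\<bar> \<le> M * G x" if "z \<in> ball x0 r" for x z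
      unfolding M_def G_def r_def
      by (rule dyadic_growth[OF IH all gamma(1) A(1)]) (use that in \<open>simp_all add: r_def\<close>)
    \<comment> \<open>The smallness of C0 persists at every scale: with h = 2r the factor h^\<gamma>
      r^(-\<alpha>) is at least h^\<alpha> h^(-\<alpha>) = 1, since h is at most 1 and \<gamma> at
      most \<alpha>.\<close>
    have C0: "C0 < M * r powr (- \<alpha>) * (c / 2)"
    proof -
      define h where "h = (1/2::real) ^ n"
      have h: "0 < h" "h \<le> 1" "r \<le> h" by (auto simp: h_def r_def power_le_one)
      have "((1/2) powr \<gamma>) ^ n = h powr \<gamma>"
        by (simp add: h_def powr_power powr_realpow[symmetric] powr_powr mult.commute)
      moreover have "h powr \<alpha> * h powr (- \<alpha>) \<le> h powr \<gamma> * r powr (- \<alpha>)"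
        using h r gamma alpha_pos by (intro mult_mono powr_mono' powr_mono2') auto
      ultimately have "1 \<le> ((1/2) powr \<gamma>) ^ n * r powr (- \<alpha>)"
        using h by (simp add: powr_add[symmetric])
      then have "A * (c / 2) * 1 \<le> A * (c / 2) * (((1/2) powr \<gamma>) ^ n * r powr (- \<alpha>))"
        using A(1) c(2) by (intro mult_left_mono mult_nonneg_nonneg) simp_all
      then show ?thesis using A(2) by (simp add: M_def mult_ac)
    qed
    define m where "m = (INF x\<in>ball x0 r. u x)"
    define S where "S = (SUP x\<in>ball x0 r. u x)"
    have ne: "ball x0 r \<noteq> {}" using r by simp
    have bd: "bdd_below (u ` ball x0 r)" "bdd_above (u ` ball x0 r)"
      using bdd by (meson bounded_imp_bdd_below bounded_imp_bdd_above bounded_subset image_mono subset_UNIV)+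
    have m: "m \<le> u x" and S: "u x \<le> S" if "x \<in> ball x0 r" for x
      unfolding m_def S_def using that bd by (auto intro: cINF_lower cSUP_upper)
    have m_growth: "u x \<le> m + M * G x" for x
    proof -
      have "u x - M * G x \<le> m"
        unfolding m_def using growth[of _ x] by (intro cINF_greatest[OF ne]) (simp add: abs_le_iff algebra_simps)
      then show ?thesis by simp
    qed
    have S_growth: "S \<le> u x + M * G x" for x
      unfolding S_def using growth[of _ x] by (intro cSUP_least[OF ne]) (simp add: abs_le_iff algebra_simps)
    have m_M: "u x \<le> m + M" if "x \<in> ball x0 r" for x
    proof -
      have "u x - M \<le> m"
        unfolding m_def using osc[OF that] by (intro cINF_greatest[OF ne]) (simp add: abs_le_iff algebra_simps)
      then show ?thesis by simp
    qed
    have S_M: "S \<le> u x + M" if "x \<in> ball x0 r" for x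
      unfolding S_def using osc[OF that] by (intro cSUP_least[OF ne]) (simp add: abs_le_iff algebra_simps)
    have mS: "S \<le> m + M" unfolding S_def using m_M by (intro cSUP_least[OF ne])
    let ?V = "unit_ball_vol DIM('a) * r ^ DIM('a)"
    let ?G1 = "{x \<in> ball x0 r. u x \<le> m + M / 2}"
    let ?G2 = "{x \<in> ball x0 r. - u x \<le> - S + M / 2}"
    have [measurable]: "u \<in> borel_measurable borel" "ball x0 r \<in> sets borel"
      using borel_measurable_continuous_onI[OF cont] by auto
    have "?G1 \<in> sets borel" "?G2 \<in> sets borel" by measurable
    then have G_meas: "?G1 \<in> sets lebesgue" "?G2 \<in> sets lebesgue" by auto
    have "?V = measure lebesgue (ball x0 r)" using r by (simp add: content_ball)
    \<comment> \<open>M bounds S - m from above, so the levels m + M/2 and S - M/2 overlap and every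
      point is in one of the two sets. One of them fills half of the ball and decides whether u or
      -u is improved.\<close>
    also have "ball x0 r = ?G1 \<union> ?G2" using mS by auto
    also have "measure lebesgue \<dots> \<le> measure lebesgue ?G1 + measure lebesgue ?G2"
      using G_meas by (rule measure_Un_le)
    finally consider "?V / 2 \<le> measure lebesgue ?G1" | "?V / 2 \<le> measure lebesgue ?G2" by linarith
    then have "\<bar>u x - u y\<bar> \<le> (1 - \<epsilon> / 4) * M"
    proof cases
      case 1
      have up: "u z \<le> m + (1 - \<epsilon> / 4) * M" if "z \<in> ball x0 (r / 2)" for z
        by (rule oscillation_step[OF cont bdd ge x0 r M m_M _ 1 gamma eps int[OF r] c(1) small C0 that])
          (use m_growth in \<open>auto simp: G_def\<close>)
      have "x \<in> ball x0 (r / 2)" "y \<in> ball x0 (r / 2)"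
        using less.prems Suc by (auto simp: r_def)
      moreover from this have "x \<in> ball x0 r" "y \<in> ball x0 r" using r by auto
      ultimately show ?thesis using up[of x] up[of y] m[of x] m[of y] by (simp add: abs_le_iff)
    next
      case 2
      have cont': "continuous_on UNIV (\<lambda>x. - u x)" using cont by (rule continuous_on_minus)
      have ge': "viscosity_ge (extremal_max lam Lam \<alpha> \<phi>) (ball 0 1) (\<lambda>x. - u x) (\<lambda>_. - C0)"
        using le by (rule viscosity_ge_minus)
      then have bdd': "bounded (range (\<lambda>x. - u x))" by (simp add: viscosity_ge_def)
      \<comment> \<open>For -u the lower end of the range is -S, so S replaces m throughout.\<close>
      have S_M': "- u x \<le> - S + M" if "x \<in> ball x0 r" for x using S_M[OF that] by simp
      have up: "- u z \<le> - S + (1 - \<epsilon> / 4) * M" if "z \<in> ball x0 (r / 2)" for z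
        by (rule oscillation_step[OF cont' bdd' ge' x0 r M S_M' _ 2 gamma eps int[OF r] c(1) small C0 that])
          (use S_growth in \<open>auto simp: G_def algebra_simps\<close>)
      have "x \<in> ball x0 (r / 2)" "y \<in> ball x0 (r / 2)"
        using less.prems Suc by (auto simp: r_def)
      moreover from this have "x \<in> ball x0 r" "y \<in> ball x0 r" using r by auto
      ultimately show ?thesis using up[of x] up[of y] S[of x] S[of y] by (simp add: abs_le_iff)
    qed
    also have "\<dots> \<le> (1/2) powr \<gamma> * M" using decay M by (intro mult_right_mono) auto
    finally show ?thesis by (simp add: M_def Suc mult_ac)
  qed
qed

text \<open>The dyadic balls are centred at x itself. With j chosen so that y is in the ball of
  radius 2^(-j-1) but 2^(-j) is at most four times the distance, the decay becomes a Hoelder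
  modulus; for distances of at least 1/2 the global bound suffices.\<close>

lemma holder_estimate:
  obtains \<gamma> C where "0 < \<gamma>" "\<gamma> < 1" "0 < C"
    "\<And>(u :: 'a::euclidean_space \<Rightarrow> real) C0 L x y. continuous_on UNIV u \<Longrightarrow> bounded (range u) \<Longrightarrow> 0 \<le> C0 \<Longrightarrow>
      viscosity_ge (extremal_max lam Lam \<alpha> \<phi>) (ball 0 1) u (\<lambda>_. - C0) \<Longrightarrow>
      viscosity_le (extremal_min lam Lam \<alpha> \<phi>) (ball 0 1) u (\<lambda>_. C0) \<Longrightarrow>
      (\<And>x. \<bar>u x\<bar> \<le> L) \<Longrightarrow> x \<in> ball 0 (1/2) \<Longrightarrow> y \<in> ball 0 (1/2) \<Longrightarrow>
      \<bar>u x - u y\<bar> \<le> C * (L + C0) * dist x y powr \<gamma>"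
proof -
  obtain C where C: "0 < C"
    "\<And>r. 0 < r \<Longrightarrow> r \<le> 1/2 \<Longrightarrow> integrable lebesgue (\<lambda>y::'a::euclidean_space. upper_kernel y * weight r y)"
    "\<And>r. 0 < r \<Longrightarrow> r \<le> 1/2 \<Longrightarrow> (LINT y::'a|lebesgue. upper_kernel y * weight r y) \<le> C * r powr (- \<alpha>)"
    using kernel_weight_integral by blast
  define c where "c = unit_ball_vol DIM('a) * lam * (2 - \<alpha>) / (16 * 2 ^ DIM('a) * 2 powr \<alpha>)"
  have c: "0 < c" using lam_pos alpha_less by (simp add: c_def)
  obtain \<gamma> \<epsilon> where g: "0 < \<gamma>" "\<gamma> < 1" "\<gamma> \<le> \<alpha> / 2" "0 < \<epsilon>" "5 powr \<gamma> + \<epsilon> \<le> 5/4"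
    "(4 * \<gamma> / \<alpha> + 2 * \<epsilon>) * C \<le> c / 2" "1 - \<epsilon> / 4 \<le> (1/2) powr \<gamma>"
    by (rule exists_small_parameters[OF C(1) c alpha_pos])
  show ?thesis
  proof (rule that[OF g(1,2), of "8 + 16 / c"])
    show "0 < 8 + 16 / c" using c by (simp add: add_pos_pos)
    fix u :: "'a \<Rightarrow> real" and C0 L :: real and x y :: 'a
    assume u: "continuous_on UNIV u" "bounded (range u)" "0 \<le> C0"
      "viscosity_ge (extremal_max lam Lam \<alpha> \<phi>) (ball 0 1) u (\<lambda>_. - C0)"
      "viscosity_le (extremal_min lam Lam \<alpha> \<phi>) (ball 0 1) u (\<lambda>_. C0)"
      and L: "\<And>x. \<bar>u x\<bar> \<le> L" and x: "x \<in> ball 0 (1/2)" and y: "y \<in> ball 0 (1/2)"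
    have "0 \<le> L" using L[of 0] by linarith
    \<comment> \<open>2L bounds the global oscillation, and 4 C0 / c makes C0 less than A c / 2.
      Strictness keeps A positive even if L = C0 = 0.\<close>
    have main: "\<bar>u x - u y\<bar> \<le> 4 * A * dist x y powr \<gamma>" if A: "2 * L + 4 * C0 / c < A" for A
    proof (cases "x = y")
      case False
      have Apos: "0 < A" using A \<open>0 \<le> L\<close> u(3) c by (smt (verit) divide_nonneg_pos)
      have "4 * C0 / c < A" using A \<open>0 \<le> L\<close> by linarith
      then have "4 * C0 < A * c" using c by (simp add: divide_less_eq)
      then have CA: "C0 < A * (c / 2)" using u(3) by simp
      have "0 \<le> 4 * C0 / c" using u(3) c by simp
      then have "2 * L < A" using A by linarith
      then have all: "\<bar>u x - u y\<bar> \<le> A" for x y using L[of x] L[of y] by linarith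
      have d: "0 < dist x y" using False by simp
      have four: "(4::real) powr \<gamma> \<le> 4" using powr_mono[of \<gamma> 1 "4::real"] g by simp
      show ?thesis
      proof (cases "dist x y < 1/2")
        case True
        then obtain j where j: "(1/2) ^ Suc j \<le> 2 * dist x y" "2 * dist x y < (1/2) ^ j"
          using dyadic_down[of "2 * dist x y"] d by auto
        have x0: "norm x < 1/2" using x by simp
        have "\<bar>u x - u y\<bar> \<le> A * ((1/2) powr \<gamma>) ^ j"
          by (rule oscillation_decay[OF u(1,2,4,5) x0 g(1,3,4,5) C(2,3) c_def c g(6,7) Apos CA all])
            (use j in auto)
        also have "((1/2) powr \<gamma>) ^ j = ((1/2) ^ j) powr \<gamma>"
          by (simp add: powr_power powr_realpow[symmetric] powr_powr mult.commute)
        also have "\<dots> \<le> (4 * dist x y) powr \<gamma>"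
          using j g by (intro powr_mono2) auto
        also have "\<dots> = 4 powr \<gamma> * dist x y powr \<gamma>" by (simp add: powr_mult)
        also have "\<dots> \<le> 4 * dist x y powr \<gamma>" using four by (intro mult_right_mono) auto
        finally show ?thesis using Apos by (simp add: mult_ac)
      next
        case False
        have "1 \<le> (4 * dist x y) powr \<gamma>" using False g by (intro ge_one_powr_ge_zero) auto
        also have "\<dots> = 4 powr \<gamma> * dist x y powr \<gamma>" by (simp add: powr_mult)
        also have "\<dots> \<le> 4 * dist x y powr \<gamma>" using four by (intro mult_right_mono) auto
        finally have "A * 1 \<le> A * (4 * dist x y powr \<gamma>)" using Apos by (intro mult_left_mono) auto
        then show ?thesis using all[of x y] by (simp add: mult_ac)
      qed
    qed simp
    \<comment> \<open>The strict inequality for A is removed by letting A decrease to its lower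
      bound.\<close>
    have "\<bar>u x - u y\<bar> \<le> 4 * (2 * L + 4 * C0 / c) * dist x y powr \<gamma>"
    proof (rule tendsto_lowerbound)
      show "((\<lambda>A. 4 * A * dist x y powr \<gamma>) \<longlongrightarrow> 4 * (2 * L + 4 * C0 / c) * dist x y powr \<gamma>) (at_right (2 * L + 4 * C0 / c))"
        by (intro tendsto_intros)
      show "\<forall>\<^sub>F A in at_right (2 * L + 4 * C0 / c). \<bar>u x - u y\<bar> \<le> 4 * A * dist x y powr \<gamma>"
        using main by (auto simp: eventually_at_filter)
    qed simp
    also have "\<dots> \<le> (8 + 16 / c) * (L + C0) * dist x y powr \<gamma>"
    proof (rule mult_right_mono)
      have "0 \<le> 16 * L / c" using c \<open>0 \<le> L\<close> by simp
      moreover have "4 * (2 * L + 4 * C0 / c) = 8 * L + 16 * C0 / c" by simp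
      moreover have "(8 + 16 / c) * (L + C0) = 8 * L + 8 * C0 + 16 * L / c + 16 * C0 / c"
        by (simp add: algebra_simps add_divide_distrib)
      ultimately show "4 * (2 * L + 4 * C0 / c) \<le> (8 + 16 / c) * (L + C0)"
        using u(3) by linarith
    qed simp
    finally show "\<bar>u x - u y\<bar> \<le> (8 + 16 / c) * (L + C0) * dist x y powr \<gamma>" .
  qed
qed

end

theorem theorem4p1:
  fixes lam Lam \<alpha> \<beta> \<kappa> :: real and \<phi> :: "real \<Rightarrow> real"
  assumes "0 < lam" and "lam \<le> Lam"
    and "0 < \<beta>" and "\<beta> < 2"
    and "\<beta> < \<alpha>" and "\<alpha> < 2"
    and "\<And>t. 0 < t \<Longrightarrow> 0 < \<phi> t"
    and "\<phi> \<in> borel_measurable (lebesgue_on {0<..})"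
    and "locally_bounded_on {0<..} \<phi>"
    and "0 < \<kappa>"
    and "\<And>s t. 1 \<le> s \<Longrightarrow> 0 < t \<Longrightarrow> \<phi> (s * t) \<le> \<kappa> * s powr \<beta> * \<phi> t"
    and "set_integrable lebesgue {0<..<1} (\<lambda>y. \<phi> y / y)"
  shows "\<exists>\<gamma> C. 0 < \<gamma> \<and> \<gamma> < 1 \<and> 0 < C \<and>
    (\<forall>(u :: 'a::euclidean_space \<Rightarrow> real) C0.
       continuous_on UNIV u \<and> bounded (range u) \<and> 0 \<le> C0 \<and>
       viscosity_ge (extremal_max lam Lam \<alpha> \<phi>) (ball 0 1) u (\<lambda>_. - C0) \<and>
       viscosity_le (extremal_min lam Lam \<alpha> \<phi>) (ball 0 1) u (\<lambda>_. C0)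
       \<longrightarrow> u \<in> holder_space \<gamma> (ball 0 (1/2)) \<and>
           holder_norm \<gamma> (ball 0 (1/2)) u \<le> C * (Linf_norm u + C0))"
proof -
  interpret extremal_kernel lam Lam \<alpha> \<beta> \<kappa> \<phi>
    using assms by unfold_locales auto
  obtain \<gamma> C where C: "0 < \<gamma>" "\<gamma> < 1" "0 < C"
    and est: "\<And>(u :: 'a \<Rightarrow> real) C0 L x y. continuous_on UNIV u \<Longrightarrow> bounded (range u) \<Longrightarrow> 0 \<le> C0 \<Longrightarrow>
      viscosity_ge (extremal_max lam Lam \<alpha> \<phi>) (ball 0 1) u (\<lambda>_. - C0) \<Longrightarrow>
      viscosity_le (extremal_min lam Lam \<alpha> \<phi>) (ball 0 1) u (\<lambda>_. C0) \<Longrightarrow>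
      (\<And>x. \<bar>u x\<bar> \<le> L) \<Longrightarrow> x \<in> ball 0 (1/2) \<Longrightarrow> y \<in> ball 0 (1/2) \<Longrightarrow>
      \<bar>u x - u y\<bar> \<le> C * (L + C0) * dist x y powr \<gamma>"
    using holder_estimate by blast
  show ?thesis
  proof (rule exI[of _ \<gamma>], rule exI[of _ "1 + C"], intro conjI allI impI)
    show "0 < \<gamma>" "\<gamma> < 1" "0 < 1 + C" using C by auto
    fix u :: "'a \<Rightarrow> real" and C0 :: real
    assume u: "continuous_on UNIV u \<and> bounded (range u) \<and> 0 \<le> C0 \<and>
       viscosity_ge (extremal_max lam Lam \<alpha> \<phi>) (ball 0 1) u (\<lambda>_. - C0) \<and>
       viscosity_le (extremal_min lam Lam \<alpha> \<phi>) (ball 0 1) u (\<lambda>_. C0)"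
    define L where "L = Linf_norm u"
    have L: "\<bar>u x\<bar> \<le> L" for x unfolding L_def using u by (intro abs_le_Linf_norm) auto
    let ?B = "ball (0::'a) (1/2)"
    have q: "q \<le> C * (L + C0)" if "q \<in> holder_quotients \<gamma> ?B u" for q
    proof -
      from that obtain x y where xy: "q = \<bar>u x - u y\<bar> / dist x y powr \<gamma>" "x \<in> ?B" "y \<in> ?B" "x \<noteq> y"
        unfolding holder_quotients_def by blast
      then show ?thesis
        using est[of u C0 L x y] u L by (simp add: divide_le_eq)
    qed
    have bdd_q: "bdd_above (holder_quotients \<gamma> ?B u)" using q by (rule bdd_aboveI)
    then show "u \<in> holder_space \<gamma> ?B"
      unfolding holder_space_def using u by (auto intro: bounded_subset)
    \<comment> \<open>Two distinct points of the ball make the set of quotients nonempty; on the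
      empty set \<open>Sup\<close> is unspecified.\<close>
    obtain b :: 'a where b: "b \<in> Basis" using nonempty_Basis by blast
    then have "(1/4) *\<^sub>R b \<in> ?B" "(1/4) *\<^sub>R b \<noteq> 0" "0 \<in> ?B" by (auto simp: nonzero_Basis)
    then have "holder_quotients \<gamma> ?B u \<noteq> {}"
      unfolding holder_quotients_def by blast
    then have "Sup (holder_quotients \<gamma> ?B u) \<le> C * (L + C0)"
      using q by (rule cSup_least)
    moreover have "(SUP x\<in>?B. \<bar>u x\<bar>) \<le> L"
      using L by (intro cSUP_least) auto
    ultimately show "holder_norm \<gamma> ?B u \<le> (1 + C) * (Linf_norm u + C0)"
      unfolding holder_norm_def L_def[symmetric] using u by (simp add: algebra_simps)
  qed
qed

end
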